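(* Let $\Lambda:[0,1]\to\mathbb{R}$ be of class $C^1$ and assume that $\lambda:=\Lambda'$ is $L_{\mathrm{LC}}$-Lipschitz continuous on $[0,1]$. Let $n\ge1$ and $\mathrm{x}\in D_n$. For all $t\ge0$, $$\|u_\infty[\mathrm{x}](t,\cdot)-u_n[\mathrm{x}](t,\cdot)\|_{L^1(\mathbb{R})}\le\frac{t\,L_{\mathrm{LC}}}{n}.$$
   Context: $H(x)=\mathbf{1}_{\{x\ge 0\}}$, so $H*m$ is the cumulative distribution function (CDF) of $m$. Entropy solution: for a CDF $u_0$, the unique weak solution $u:[0,+\infty)\times\mathbb{R}\to[0,1]$ of $\partial_t u+\partial_x(\Lambda(u))=0$ with initial condition $u_0$ satisfying Kruzkov's entropy condition: for all $c\in[0,1]$, $\partial_t|u-c|+\partial_x(\mathrm{sgn}(u-c)(\Lambda(u)-\Lambda(c)))\le0$ in the distributional sense (with initial datum $u_0$). For all $t\ge0$, $u(t,\cdot)$ coincides almost everywhere with the CDF of a probability measure (Kruzkov's theorem; the solution is taken continuous in time with values in $L^1_{\mathrm{loc}}(\mathbb{R})$). Sticky particle dynamics (SPD): $D_n:=\{(x_1,\ldots,x_n)\in\mathbb{R}^n:x_1\le\cdots\le x_n\}$. For $\mathrm{x}\in D_n$ and $\bar\lambda\in\mathbb{R}^n$, $\phi[\bar\lambda](\mathrm{x};t)\in D_n$ is the vector of positions at time $t$ of $n$ particles of mass $1/n$, the $k$-th one starting at $x_k$ with velocity $\bar\lambda_k$; particles move at constant velocity and stick together at collisions, with conservation of mass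 and momentum. Explicitly (also when several particles share the same initial position): let $Q_t$ be the function on $[0,1]$, linear on each $[(k-1)/n,k/n]$, with $Q_t(0)=0$ and $Q_t(k/n)=\sum_{k'=1}^k(x_{k'}+t\bar\lambda_{k'})$, and let $P_t$ be its convex hull (greatest convex minorant); then $\phi_k[\bar\lambda](\mathrm{x};t)=P_t(k/n)-P_t((k-1)/n)$. The initial velocities are $\bar\lambda_k:=n\int_{(k-1)/n}^{k/n}\lambda(w)\,dw$. Set $\mu_0[\mathrm{x}]:=\frac1n\sum_{k=1}^n\delta_{x_k}$ and $u_n[\mathrm{x}](t,x):=\frac1n\sum_{k=1}^n\mathbf{1}_{\{\phi_k[\bar\lambda](\mathrm{x};t)\le x\}}$. Finally $u_\infty[\mathrm{x}]$ denotes the entropy solution of $\partial_tu+\partial_x(\Lambda(u))=0$ with discrete initial condition $u_{\infty,0}[\mathrm{x}]:=H*\mu_0[\mathrm{x}]$. *)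

theory Defs
  imports "HOL-Probability.Probability"
begin

section \<open>Entropy solutions of scalar conservation laws\<close>

text \<open>The functions \<open>D i j\<close> witness the mixed partial derivatives of order \<open>i\<close> in the first
  and \<open>j\<close> in the second variable; together the conditions say that \<open>\<phi>\<close> is of class
  \<open>C\<close>-infinity on the plane.\<close>

definition smooth_plane :: "(real \<Rightarrow> real \<Rightarrow> real) \<Rightarrow> bool" where
  "smooth_plane \<phi> \<longleftrightarrow> (\<exists>D :: nat \<Rightarrow> nat \<Rightarrow> real \<Rightarrow> real \<Rightarrow> real.
      D 0 0 = \<phi> \<and>
      (\<forall>i j. continuous_on UNIV (\<lambda>(t, x). D i j t x)) \<and>
      (\<forall>i j t x. ((\<lambda>s. D i j s x) has_real_derivative D (Suc i) j t x) (at t)) \<and>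
      (\<forall>i j t x. ((\<lambda>y. D i j t y) has_real_derivative D i (Suc j) t x) (at x)))"

text \<open>Test functions on the closed half-plane \<open>t \<ge> 0\<close> are restrictions of compactly supported
  smooth functions on the plane; they need not vanish at \<open>t = 0\<close>.\<close>

definition test_function :: "(real \<Rightarrow> real \<Rightarrow> real) \<Rightarrow> bool" where
  "test_function \<phi> \<longleftrightarrow> smooth_plane \<phi> \<and> compact (closure {(t, x). \<phi> t x \<noteq> 0})"

definition weak_solution ::
    "(real \<Rightarrow> real) \<Rightarrow> (real \<Rightarrow> real) \<Rightarrow> (real \<Rightarrow> real \<Rightarrow> real) \<Rightarrow> bool" where
  "weak_solution \<Lambda> u0 u \<longleftrightarrow> (\<forall>\<phi>. test_function \<phi> \<longrightarrow>
      set_lebesgue_integral lborel ({0..} \<times> UNIV)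
        (\<lambda>(t, x). u t x * deriv (\<lambda>s. \<phi> s x) t + \<Lambda> (u t x) * deriv (\<lambda>y. \<phi> t y) x)
      + (LINT x|lborel. u0 x * \<phi> 0 x) = 0)"

definition kruzkov_condition ::
    "(real \<Rightarrow> real) \<Rightarrow> (real \<Rightarrow> real) \<Rightarrow> (real \<Rightarrow> real \<Rightarrow> real) \<Rightarrow> bool" where
  "kruzkov_condition \<Lambda> u0 u \<longleftrightarrow>
     (\<forall>c\<in>{0..1}. \<forall>\<phi>. test_function \<phi> \<and> (\<forall>t\<ge>0. \<forall>x. 0 \<le> \<phi> t x) \<longrightarrow>
      0 \<le> set_lebesgue_integral lborel ({0..} \<times> UNIV)
            (\<lambda>(t, x). \<bar>u t x - c\<bar> * deriv (\<lambda>s. \<phi> s x) t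
               + sgn (u t x - c) * (\<Lambda> (u t x) - \<Lambda> c) * deriv (\<lambda>y. \<phi> t y) x)
          + (LINT x|lborel. \<bar>u0 x - c\<bar> * \<phi> 0 x))"

definition continuous_in_L1_loc :: "(real \<Rightarrow> real \<Rightarrow> real) \<Rightarrow> bool" where
  "continuous_in_L1_loc u \<longleftrightarrow> (\<forall>t\<ge>0. \<forall>a b.
      ((\<lambda>s. LINT x:{a..b}|lborel. \<bar>u s x - u t x\<bar>) \<longlongrightarrow> 0) (at t within {0..}))"

text \<open>Only the values of \<open>u t\<close> for \<open>t \<ge> 0\<close> and of \<open>\<Lambda>\<close> on \<open>[0,1]\<close> are relevant.
  By Kruzkov's theorem \<open>u\<close> is unique up to a null set for each \<open>t\<close>.\<close>

definition entropy_solution ::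
    "(real \<Rightarrow> real) \<Rightarrow> (real \<Rightarrow> real) \<Rightarrow> (real \<Rightarrow> real \<Rightarrow> real) \<Rightarrow> bool" where
  "entropy_solution \<Lambda> u0 u \<longleftrightarrow>
      (\<forall>t\<ge>0. \<forall>x. u t x \<in> {0..1}) \<and>
      (\<lambda>(t, x). u t x) \<in> borel_measurable (restrict_space borel ({0..} \<times> UNIV)) \<and>
      (AE x in lborel. u 0 x = u0 x) \<and>
      weak_solution \<Lambda> u0 u \<and>
      kruzkov_condition \<Lambda> u0 u \<and>
      continuous_in_L1_loc u"

section \<open>Sticky particle dynamics\<close>

text \<open>Vectors of length \<open>n\<close> are functions on \<open>nat\<close> of which only the values at \<open>1, \<dots>, n\<close> are
  used.\<close>

definition empirical_measure :: "nat \<Rightarrow> (nat \<Rightarrow> real) \<Rightarrow> real measure" where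
  "empirical_measure n x = distr (uniform_count_measure {1..n}) borel x"

definition mean_velocity :: "(real \<Rightarrow> real) \<Rightarrow> nat \<Rightarrow> nat \<Rightarrow> real" where
  "mean_velocity lam n k = real n * (LINT w:{(real k - 1) / real n .. real k / real n}|lborel. lam w)"

text \<open>The piecewise linear interpolation \<open>Q\<^sub>t\<close> of the partial sums of \<open>x k + t * v k\<close> at the
  points \<open>k / n\<close>: the clamped factor of the \<open>k\<close>-th term is \<open>0\<close> to the left of
  \<open>[(k-1)/n, k/n]\<close>, grows linearly from \<open>0\<close> to \<open>1\<close> on this interval, and is \<open>1\<close> to its right.\<close>

definition free_interp :: "nat \<Rightarrow> (nat \<Rightarrow> real) \<Rightarrow> (nat \<Rightarrow> real) \<Rightarrow> real \<Rightarrow> real \<Rightarrow> real" where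
  "free_interp n v x t w =
     (\<Sum>k=1..n. (x k + t * v k) * max 0 (min 1 (real n * w - (real k - 1))))"

lemma free_interp_node:
  assumes "k \<le> n" "n \<ge> 1"
  shows "free_interp n v x t (real k / real n) = (\<Sum>j=1..k. x j + t * v j)"
proof -
  have "free_interp n v x t (real k / real n)
      = (\<Sum>j=1..n. if j \<le> k then x j + t * v j else 0)"
    unfolding free_interp_def using assms by (intro sum.cong) auto
  also have "\<dots> = (\<Sum>j=1..k. x j + t * v j)"
    using assms by (intro sum.mono_neutral_cong_right) auto
  finally show ?thesis .
qed

definition greatest_convex_minorant :: "(real \<Rightarrow> real) \<Rightarrow> real \<Rightarrow> real" where
  "greatest_convex_minorant Q w =
     Sup {h w | h. convex_on {0..1} h \<and> (\<forall>z\<in>{0..1}. h z \<le> Q z)}"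

definition sticky_position :: "nat \<Rightarrow> (nat \<Rightarrow> real) \<Rightarrow> (nat \<Rightarrow> real) \<Rightarrow> real \<Rightarrow> nat \<Rightarrow> real" where
  "sticky_position n v x t k =
     greatest_convex_minorant (free_interp n v x t) (real k / real n)
     - greatest_convex_minorant (free_interp n v x t) ((real k - 1) / real n)"

definition sticky_cdf ::
    "(real \<Rightarrow> real) \<Rightarrow> nat \<Rightarrow> (nat \<Rightarrow> real) \<Rightarrow> real \<Rightarrow> real \<Rightarrow> real" where
  "sticky_cdf lam n x t y =
     (1 / real n) * (\<Sum>k=1..n. indicator {..y} (sticky_position n (mean_velocity lam n) x t k))"

end

theory Submission
  imports Defs "HOL-Computational_Algebra.Polynomial" "HOL-Real_Asymp.Real_Asymp"
begin

text \<open>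
The proof compares \<open>u\<close> with a smooth approximation of the sticky particle solution that does not
resolve any collision.

Write \<open>c\<^sub>k = k / n\<close> and let \<open>A\<^sub>k\<close> be \<open>1 / n\<close> times the sum of the first \<open>k\<close> initial positions.  Consider the
energies \<open>E\<^sub>k(t, y) = c\<^sub>k y - A\<^sub>k - t \<Lambda>(c\<^sub>k)\<close> for \<open>k = 0, \<dots>, n\<close>.  Sticky positions are increments of a
greatest convex minorant, so by Legendre duality the sticky CDF at \<open>(t, y)\<close> is \<open>c\<^sub>K\<close>, where \<open>K\<close> is the
unique maximiser of \<open>k \<mapsto> E\<^sub>k(t, y)\<close>, for all but finitely many \<open>y\<close> (lemmas \<open>sticky_argmax\<close> and
\<open>energy_argmax\<close>).  The Gibbs weights \<open>w\<^sub>k\<close>, proportional to \<open>exp (E\<^sub>k / \<epsilon>)\<close>, are smooth on the whole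
plane and concentrate on \<open>K\<close> as \<open>\<epsilon>\<close> tends to \<open>0\<close>; the integral over a bounded
interval of the sum of \<open>w\<^sub>k \<bar>u - c\<^sub>k\<bar>\<close> over \<open>k\<close> therefore tends to the \<open>L1\<close> distance in question on this
interval.

To bound it, Kruzkov's inequality for \<open>u\<close> with the constant \<open>c\<^sub>k\<close> is tested with \<open>w\<^sub>k\<close> times cutoffs
in time and along a cone of maximal speed, and summed over \<open>k\<close>.  The derivative of the cone has
the favourable sign (lemma \<open>cone_transport\<close>), that of the time cutoff produces the distance at the
final time, and the derivatives of the weights leave an entropy production.  As a derivative of Gibbs
weights it is a covariance, and equals \<open>1 / (2 \<epsilon>)\<close> times a sum over pairs \<open>k, l\<close> of
\<open>w\<^sub>k w\<^sub>l B\<^sub>k\<^sub>l\<close> (lemma \<open>production_eq\<close>).  The pair term \<open>B\<^sub>k\<^sub>l\<close> vanishes unless \<open>u\<close> lies strictly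
between \<open>c\<^sub>k\<close> and \<open>c\<^sub>l\<close>; there it is \<open>2 \<bar>c\<^sub>k - c\<^sub>l\<bar>\<close> times the height of the chord of \<open>\<Lambda>\<close> above \<open>\<Lambda>\<close> at
\<open>u\<close>.  Two cases remain.

\<^item> If the chord lies below \<open>\<Lambda>\<close> at all grid points in between, its height above \<open>\<Lambda>\<close> is at most the error
  of piecewise linear interpolation, \<open>L / (4 n\<^sup>2)\<close>, and \<open>B\<^sub>k\<^sub>l\<close> is at most \<open>L / (2 n) (c\<^sub>k - c\<^sub>l)\<^sup>2\<close> (lemma
  \<open>pair_production_chord_below\<close>).
\<^item> Otherwise the jump would open into a rarefaction: as \<open>A\<close> is convex in \<open>k\<close>, the energy is lifted at some
  intermediate grid point by at least \<open>t \<kappa>\<close> above the convex combination of the energies at \<open>k\<close> and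
  \<open>l\<close>, with a fixed \<open>\<kappa> > 0\<close>, and \<open>w\<^sub>k w\<^sub>l\<close> is at most \<open>exp (- t \<kappa> / \<epsilon>)\<close> (lemma \<open>min_weight_le\<close>).

The variance of the \<open>c\<^sub>k\<close> divided by \<open>\<epsilon>\<close>, which is \<open>1 / (2 \<epsilon>)\<close> times the sum of
\<open>w\<^sub>k w\<^sub>l (c\<^sub>k - c\<^sub>l)\<^sup>2\<close>, is the spatial derivative of the
average of the \<open>c\<^sub>k\<close>, an increasing function with values in \<open>[0, 1]\<close>, so its integral over space is at
most \<open>1\<close>.  Hence the production up to time \<open>t\<close> is at most \<open>t L / (2 n)\<close> plus a term that vanishes with
\<open>\<epsilon>\<close>, and the initial distance vanishes with \<open>\<epsilon>\<close> as well because the sticky CDF starts from the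
initial datum of \<open>u\<close>.
\<close>

section \<open>Smooth functions of two variables\<close>

definition partials_of :: "(nat \<Rightarrow> nat \<Rightarrow> real \<Rightarrow> real \<Rightarrow> real) \<Rightarrow> bool" where
  "partials_of D \<longleftrightarrow>
      (\<forall>i j. continuous_on UNIV (\<lambda>(t, x). D i j t x)) \<and>
      (\<forall>i j t x. ((\<lambda>s. D i j s x) has_real_derivative D (Suc i) j t x) (at t)) \<and>
      (\<forall>i j t x. ((\<lambda>y. D i j t y) has_real_derivative D i (Suc j) t x) (at x))"

lemma smooth_plane_iff: "smooth_plane \<phi> \<longleftrightarrow> (\<exists>D. D 0 0 = \<phi> \<and> partials_of D)"
  unfolding smooth_plane_def partials_of_def by blast

text \<open>Smoothness on the plane is stated by a whole array of mixed partial derivatives, so closure under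
products and reciprocals would call for a two-dimensional Leibniz rule.  Formal expressions avoid
it: differentiation becomes a syntactic operation on expressions, and the array of a compound
function is obtained by iterating the two derivations.  A leaf carries an array of partial
derivatives, and a derivation shifts that array.\<close>

datatype expr = Jet "nat \<Rightarrow> nat \<Rightarrow> real \<Rightarrow> real \<Rightarrow> real"
  | Plus expr expr | Times expr expr | Recip expr

primrec denote :: "expr \<Rightarrow> real \<Rightarrow> real \<Rightarrow> real" where
  "denote (Jet D) = D 0 0"
| "denote (Plus a b) = (\<lambda>t x. denote a t x + denote b t x)"
| "denote (Times a b) = (\<lambda>t x. denote a t x * denote b t x)"
| "denote (Recip a) = (\<lambda>t x. inverse (denote a t x))"

abbreviation minus_one :: expr where
  "minus_one \<equiv> Jet (\<lambda>i j t x. if i = 0 \<and> j = 0 then - 1 else 0)"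

primrec d_t :: "expr \<Rightarrow> expr" where
  "d_t (Jet D) = Jet (\<lambda>i j. D (Suc i) j)"
| "d_t (Plus a b) = Plus (d_t a) (d_t b)"
| "d_t (Times a b) = Plus (Times (d_t a) b) (Times a (d_t b))"
| "d_t (Recip a) = Times minus_one (Times (Times (Recip a) (Recip a)) (d_t a))"

primrec d_x :: "expr \<Rightarrow> expr" where
  "d_x (Jet D) = Jet (\<lambda>i j. D i (Suc j))"
| "d_x (Plus a b) = Plus (d_x a) (d_x b)"
| "d_x (Times a b) = Plus (Times (d_x a) b) (Times a (d_x b))"
| "d_x (Recip a) = Times minus_one (Times (Times (Recip a) (Recip a)) (d_x a))"

primrec wf_expr :: "expr \<Rightarrow> bool" where
  "wf_expr (Jet D) = partials_of D"
| "wf_expr (Plus a b) = (wf_expr a \<and> wf_expr b)"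
| "wf_expr (Times a b) = (wf_expr a \<and> wf_expr b)"
| "wf_expr (Recip a) = (wf_expr a \<and> (\<forall>t x. denote a t x \<noteq> 0))"

lemma partials_of_const: "partials_of (\<lambda>i j t x. if i = 0 \<and> j = 0 then c else 0)"
  unfolding partials_of_def by (auto simp: case_prod_beta intro!: derivative_eq_intros)

lemma wf_d_t: "wf_expr e \<Longrightarrow> wf_expr (d_t e)"
  by (induction e) (auto simp: partials_of_const, auto simp: partials_of_def)

lemma wf_d_x: "wf_expr e \<Longrightarrow> wf_expr (d_x e)"
  by (induction e) (auto simp: partials_of_const, auto simp: partials_of_def)

lemma denote_has_derivative_t:
  "wf_expr e \<Longrightarrow> ((\<lambda>s. denote e s x) has_real_derivative denote (d_t e) t x) (at t)"
  by (induction e) (auto simp: partials_of_def intro!: derivative_eq_intros)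

lemma denote_has_derivative_x:
  "wf_expr e \<Longrightarrow> ((\<lambda>y. denote e t y) has_real_derivative denote (d_x e) t x) (at x)"
  by (induction e) (auto simp: partials_of_def intro!: derivative_eq_intros)

lemma continuous_on_denote: "wf_expr e \<Longrightarrow> continuous_on UNIV (\<lambda>(t, x). denote e t x)"
  by (induction e) (auto simp: partials_of_def case_prod_beta intro!: continuous_intros)

text \<open>The entries of the array in \<open>smooth_plane\<close> have to satisfy both derivative relations at once, so the
two derivations must commute.  They do so only up to the denoted function, not as syntax; the next
three lemmas push this through iterated derivatives, using that derivatives are unique.\<close>

lemma denote_commute: "denote (d_x (d_t e)) = denote (d_t (d_x e))"
  by (induction e) (auto simp: fun_eq_iff algebra_simps)

lemma denote_cong_d_t:
  assumes "wf_expr a" "wf_expr b" "denote a = denote b"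
  shows "denote (d_t a) = denote (d_t b)"
proof (intro ext)
  fix t x
  show "denote (d_t a) t x = denote (d_t b) t x"
    using denote_has_derivative_t[OF assms(1), of x t] denote_has_derivative_t[OF assms(2), of x t]
    by (simp add: assms(3) DERIV_unique)
qed

lemma wf_iterate: "wf_expr e \<Longrightarrow> wf_expr ((d_t ^^ i) ((d_x ^^ j) e))"
proof -
  assume "wf_expr e"
  then have "wf_expr ((d_x ^^ j) e)" by (induction j) (auto intro: wf_d_x)
  then show ?thesis by (induction i) (auto intro: wf_d_t)
qed

lemma denote_d_x_iterate:
  assumes "wf_expr e"
  shows "denote (d_x ((d_t ^^ i) e)) = denote ((d_t ^^ i) (d_x e))"
proof (induction i)
  case (Suc i)
  have "denote (d_x ((d_t ^^ Suc i) e)) = denote (d_t (d_x ((d_t ^^ i) e)))"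
    by (simp add: denote_commute)
  also have "\<dots> = denote (d_t ((d_t ^^ i) (d_x e)))"
    using wf_iterate[OF assms, of i 0] wf_iterate[OF assms, of i 1]
          wf_iterate[OF wf_d_x[OF assms], of i 0] Suc
    by (intro denote_cong_d_t) (auto intro: wf_d_x)
  finally show ?case by simp
qed simp

lemma smooth_plane_denote:
  assumes "wf_expr e"
  shows "smooth_plane (denote e)"
proof -
  let ?D = "\<lambda>i j. denote ((d_t ^^ i) ((d_x ^^ j) e))"
  have "((\<lambda>y. ?D i j t y) has_real_derivative ?D i (Suc j) t x) (at x)" for i j t x
    using denote_has_derivative_x[OF wf_iterate[OF assms, of i j], of t x]
          denote_d_x_iterate[OF wf_iterate[OF assms, of 0 j], of i] by simp
  then have "partials_of ?D"
    unfolding partials_of_def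
    using continuous_on_denote[OF wf_iterate[OF assms]] denote_has_derivative_t[OF wf_iterate[OF assms]]
    by auto
  then show ?thesis
    unfolding smooth_plane_iff by (intro exI[of _ ?D]) simp
qed

lemma smooth_plane_expr: "smooth_plane \<phi> \<longleftrightarrow> (\<exists>e. wf_expr e \<and> denote e = \<phi>)"
  using smooth_plane_denote by (metis smooth_plane_iff denote.simps(1) wf_expr.simps(1))

lemma smooth_plane_const: "smooth_plane (\<lambda>t x. c)"
  unfolding smooth_plane_iff using partials_of_const[of c]
  by (intro exI[of _ "\<lambda>i j t x. if i = 0 \<and> j = 0 then c else 0"]) auto

lemma smooth_plane_add:
  assumes "smooth_plane \<phi>" "smooth_plane \<psi>"
  shows "smooth_plane (\<lambda>t x. \<phi> t x + \<psi> t x)"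
  using assms unfolding smooth_plane_expr by (metis denote.simps(2) wf_expr.simps(2))

lemma smooth_plane_mult:
  assumes "smooth_plane \<phi>" "smooth_plane \<psi>"
  shows "smooth_plane (\<lambda>t x. \<phi> t x * \<psi> t x)"
  using assms unfolding smooth_plane_expr by (metis denote.simps(3) wf_expr.simps(3))

lemma smooth_plane_inverse:
  assumes "smooth_plane \<phi>" "\<And>t x. \<phi> t x \<noteq> 0"
  shows "smooth_plane (\<lambda>t x. inverse (\<phi> t x))"
  using assms unfolding smooth_plane_expr by (metis denote.simps(4) wf_expr.simps(4))

lemma smooth_plane_sum:
  assumes "finite A" "\<And>k. k \<in> A \<Longrightarrow> smooth_plane (\<phi> k)"
  shows "smooth_plane (\<lambda>t x. \<Sum>k\<in>A. \<phi> k t x)"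
  using assms by (induction A rule: finite_induct) (auto intro: smooth_plane_const smooth_plane_add)

definition smooth_line :: "(real \<Rightarrow> real) \<Rightarrow> bool" where
  "smooth_line f \<longleftrightarrow> (\<exists>F :: nat \<Rightarrow> real \<Rightarrow> real. F 0 = f \<and>
      (\<forall>k y. (F k has_real_derivative F (Suc k) y) (at y)))"

lemma smooth_plane_compose_affine:
  assumes "smooth_line f"
  shows "smooth_plane (\<lambda>t x. f (a * t + b * x + c))"
proof -
  obtain F :: "nat \<Rightarrow> real \<Rightarrow> real" where F: "F 0 = f" "\<And>k y. (F k has_real_derivative F (Suc k) y) (at y)"
    using assms unfolding smooth_line_def by blast
  have cont: "continuous_on UNIV (F k)" for k
    using F(2) by (meson DERIV_continuous_on has_field_derivative_at_within)
  let ?D = "\<lambda>i j t x. a ^ i * b ^ j * F (i + j) (a * t + b * x + c)"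
  have 1: "continuous_on UNIV (\<lambda>(t, x). ?D i j t x)" for i j
    unfolding case_prod_beta
    by (intro continuous_intros continuous_on_compose2[OF cont]) auto
  have 2: "((\<lambda>s. ?D i j s x) has_real_derivative ?D (Suc i) j t x) (at t)" for i j t x
    by (rule derivative_eq_intros DERIV_chain'[OF _ F(2)] refl | simp)+
  have 3: "((\<lambda>y. ?D i j t y) has_real_derivative ?D i (Suc j) t x) (at x)" for i j t x
    by (rule derivative_eq_intros DERIV_chain'[OF _ F(2)] refl | simp)+
  show ?thesis
    unfolding smooth_plane_iff partials_of_def
    by (intro exI[of _ ?D] conjI allI 1 2 3) (use F(1) in auto)
qed

text \<open>This is how one-dimensional functions inherit closure under products from the plane.\<close>

lemma smooth_line_section:
  assumes "smooth_plane \<phi>"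
  shows "smooth_line (\<lambda>y. \<phi> t y)"
proof -
  obtain D where D: "D 0 0 = \<phi>" "partials_of D" using assms smooth_plane_iff by blast
  show ?thesis
    unfolding smooth_line_def
    by (intro exI[of _ "\<lambda>k y. D 0 k t y"]) (use D in \<open>auto simp: partials_of_def\<close>)
qed

lemma smooth_line_exp: "smooth_line exp"
  unfolding smooth_line_def by (intro exI[of _ "\<lambda>_. exp"]) (auto intro: DERIV_exp)

lemma smooth_plane_continuous: "smooth_plane \<phi> \<Longrightarrow> continuous_on UNIV (\<lambda>(t, x). \<phi> t x)"
  unfolding smooth_plane_def by metis

lemma smooth_plane_deriv_t:
  assumes "smooth_plane \<phi>"
  shows "continuous_on UNIV (\<lambda>(t, x). deriv (\<lambda>s. \<phi> s x) t)"
proof -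
  obtain D where D: "D 0 0 = \<phi>" "partials_of D" using assms smooth_plane_iff by blast
  then have "deriv (\<lambda>s. \<phi> s x) t = D 1 0 t x" for t x
    by (intro DERIV_imp_deriv) (auto simp: partials_of_def)
  then show ?thesis using D(2) unfolding partials_of_def by simp
qed

lemma smooth_plane_deriv_x:
  assumes "smooth_plane \<phi>"
  shows "continuous_on UNIV (\<lambda>(t, x). deriv (\<lambda>y. \<phi> t y) x)"
proof -
  obtain D where D: "D 0 0 = \<phi>" "partials_of D" using assms smooth_plane_iff by blast
  then have "deriv (\<lambda>y. \<phi> t y) x = D 0 1 t x" for t x
    by (intro DERIV_imp_deriv) (auto simp: partials_of_def)
  then show ?thesis using D(2) unfolding partials_of_def by simp
qed

section \<open>A smooth step\<close>

text \<open>The classical function that is smooth but not analytic at \<open>0\<close>, with a polynomial factor in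
\<open>1 / y\<close>.  With this factor the family is closed under differentiation.\<close>

definition flat_exp :: "real poly \<Rightarrow> real \<Rightarrow> real" where
  "flat_exp p y = (if y > 0 then poly p (inverse y) * exp (- inverse y) else 0)"

lemma poly_times_exp_tendsto_0: "((\<lambda>z. poly p z * exp (- z)) \<longlongrightarrow> (0::real)) at_top"
proof (induction p)
  case (pCons a p)
  have *: "((\<lambda>z. z * (poly p z * exp (- z))) \<longlongrightarrow> (0::real)) at_top" for p :: "real poly"
  proof -
    have "((\<lambda>z. \<Sum>i\<le>degree p. coeff p i * (z ^ Suc i / exp z)) \<longlongrightarrow> (\<Sum>i\<le>degree p. coeff p i * 0)) at_top"
      by (intro tendsto_intros tendsto_power_div_exp_0)
    then show ?thesis
      by (simp add: poly_altdef sum_distrib_left sum_distrib_right exp_minus field_simps)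
  qed
  have "((\<lambda>z. a * (z ^ 0 / exp z) + z * (poly p z * exp (- z))) \<longlongrightarrow> a * 0 + 0) at_top"
    by (intro tendsto_intros * tendsto_power_div_exp_0)
  then show ?case by (simp add: exp_minus field_simps)
qed simp

text \<open>Dividing by \<open>y\<close> only multiplies the polynomial by its variable, and the exponential beats every
polynomial; this is the difference quotient at \<open>0\<close>.\<close>

lemma flat_exp_over_y_tendsto_0: "((\<lambda>y. flat_exp p y / y) \<longlongrightarrow> 0) (at 0)"
proof (rule filterlim_split_at)
  have "((\<lambda>z. poly (pCons 0 p) z * exp (- z)) \<longlongrightarrow> (0::real)) at_top"
    by (rule poly_times_exp_tendsto_0)
  then have "((\<lambda>y. poly (pCons 0 p) (inverse y) * exp (- inverse y)) \<longlongrightarrow> (0::real)) (at_right 0)"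
    by (rule filterlim_compose) (rule filterlim_inverse_at_top_right)
  then show "((\<lambda>y. flat_exp p y / y) \<longlongrightarrow> 0) (at_right 0)"
    by (rule Lim_transform_eventually)
       (auto simp: eventually_at_right_field flat_exp_def field_simps intro!: exI[of _ 1])
  show "((\<lambda>y. flat_exp p y / y) \<longlongrightarrow> 0) (at_left 0)"
    by (rule Lim_transform_eventually[OF tendsto_const])
       (auto simp: eventually_at_left_field flat_exp_def intro!: exI[of _ "-1"])
qed

lemma flat_exp_has_derivative:
  "(flat_exp p has_real_derivative flat_exp (monom 1 2 * (p - pderiv p)) y) (at y)"
proof -
  consider "y > 0" | "y = 0" | "y < 0" by linarith
  then show ?thesis
  proof cases
    case 1
    have "((\<lambda>y. poly p (inverse y) * exp (- inverse y)) has_real_derivative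
            flat_exp (monom 1 2 * (p - pderiv p)) y) (at y)"
      using 1
      by (auto intro!: derivative_eq_intros simp: flat_exp_def poly_monom power2_eq_square field_simps)
    then show ?thesis
      by (rule has_field_derivative_transform_within_open[where S = "{0<..}"])
         (use 1 in \<open>auto simp: flat_exp_def\<close>)
  next
    case 2
    have "((\<lambda>h. (flat_exp p (0 + h) - flat_exp p 0) / h) \<longlongrightarrow> 0) (at 0)"
      using flat_exp_over_y_tendsto_0[of p] by (simp add: flat_exp_def[of p 0])
    then show ?thesis
      using 2 by (simp add: DERIV_def flat_exp_def)
  next
    case 3
    have "((\<lambda>y. 0) has_real_derivative flat_exp (monom 1 2 * (p - pderiv p)) y) (at y)"
      using 3 by (simp add: flat_exp_def)
    then show ?thesis
      by (rule has_field_derivative_transform_within_open[where S = "{..<0}"])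
         (use 3 in \<open>auto simp: flat_exp_def\<close>)
  qed
qed

lemma smooth_line_flat_exp: "smooth_line (flat_exp p)"
  unfolding smooth_line_def
  by (intro exI[of _ "\<lambda>k. flat_exp (((\<lambda>q. monom 1 2 * (q - pderiv q)) ^^ k) p)"])
     (simp add: flat_exp_has_derivative)

lemma smooth_line_antiderivative:
  assumes "smooth_line f"
  obtains G where "\<And>y. (G has_real_derivative f y) (at y)" "smooth_line G"
proof -
  obtain F :: "nat \<Rightarrow> real \<Rightarrow> real" where F: "F 0 = f" "\<And>k y. (F k has_real_derivative F (Suc k) y) (at y)"
    using assms unfolding smooth_line_def by blast
  have "\<exists>G. \<forall>y::real. -\<infinity> < ereal y \<longrightarrow> ereal y < \<infinity> \<longrightarrow> (G has_vector_derivative f y) (at y)"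
  proof (rule einterval_antiderivative)
    show "isCont f y" for y using F DERIV_isCont by blast
  qed simp
  then obtain G where G: "\<And>y. (G has_real_derivative f y) (at y)"
    by (auto simp: has_real_derivative_iff_has_vector_derivative)
  have "smooth_line G"
    unfolding smooth_line_def
    by (intro exI[of _ "case_nat G F"]) (auto simp: G F split: nat.split)
  with G show ?thesis by (rule that)
qed

text \<open>The product \<open>flat_exp 1 y * flat_exp 1 (1 - y)\<close> is a smooth bump supported in \<open>[0, 1]\<close>; the step is
its antiderivative, normalised to rise from \<open>0\<close> to \<open>1\<close>.\<close>

lemma smooth_step_exists:
  obtains g g' :: "real \<Rightarrow> real" where
    "smooth_line g" "\<And>y. (g has_real_derivative g' y) (at y)" "\<And>y. 0 \<le> g' y"
    "\<And>y. y \<le> 0 \<Longrightarrow> g y = 0" "\<And>y. y \<ge> 1 \<Longrightarrow> g y = 1" "\<And>y. y \<notin> {0<..<1} \<Longrightarrow> g' y = 0"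
    "continuous_on UNIV g'"
proof -
  define b where "b y = flat_exp 1 y * flat_exp 1 (1 - y)" for y
  have "smooth_plane (\<lambda>t x. flat_exp 1 (0 * t + 1 * x + 0) * flat_exp 1 (0 * t + (-1) * x + 1))"
    by (intro smooth_plane_mult smooth_plane_compose_affine smooth_line_flat_exp)
  from smooth_line_section[OF this] have "smooth_line b"
    by (simp add: b_def[abs_def])
  then obtain G where G: "\<And>y. (G has_real_derivative b y) (at y)" "smooth_line G"
    using smooth_line_antiderivative by blast
  have b_cont: "continuous_on UNIV b"
    using \<open>smooth_line b\<close>
    unfolding smooth_line_def by (metis DERIV_continuous_on has_field_derivative_at_within)
  have b0: "b y = 0" if "y \<notin> {0<..<1}" for y
    using that by (auto simp: b_def flat_exp_def)
  have bpos: "b y > 0" if "y \<in> {0<..<1}" for y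
    using that by (auto simp: b_def flat_exp_def)
  have bnn: "b y \<ge> 0" for y using b0[of y] bpos[of y] by (cases "y \<in> {0<..<1}") auto
  obtain z where "0 < z" "z < 1" "G 1 - G 0 = b z"
    using MVT2[of 0 1 G b] G(1) by auto
  then have d: "G 1 - G 0 > 0" using bpos[of z] by simp
  define g where "g y = (G y - G 0) / (G 1 - G 0)" for y
  have Gc: "G y = G z" if "y \<le> z" "z \<le> 0 \<or> 1 \<le> y" for y z
  proof (cases "y = z")
    case False
    with that have "y < z" by simp
    from MVT2[OF this, of G b] G(1)
    obtain w where "y < w" "w < z" "G z - G y = (z - y) * b w" by blast
    then show ?thesis using b0[of w] that by auto
  qed simp
  have "smooth_plane (\<lambda>t x. (G (0 * t + 1 * x + 0) + (- G 0)) * (1 / (G 1 - G 0)))"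
    by (intro smooth_plane_mult smooth_plane_compose_affine smooth_plane_add smooth_plane_const G(2))
  from smooth_line_section[OF this] have "smooth_line g"
    by (simp add: g_def[abs_def])
  moreover have "(g has_real_derivative b y / (G 1 - G 0)) (at y)" for y
    unfolding g_def[abs_def] using d by (auto intro!: derivative_eq_intros G(1))
  moreover have "g y = 0" if "y \<le> 0" for y using Gc[of y 0] that by (simp add: g_def)
  moreover have "g y = 1" if "y \<ge> 1" for y using Gc[of 1 y] that d by (simp add: g_def)
  ultimately show ?thesis
    using d bnn b0 b_cont by (intro that[of g "\<lambda>y. b y / (G 1 - G 0)"]) (auto intro!: continuous_intros)
qed

section \<open>Gibbs weights\<close>

definition gibbs :: "nat \<Rightarrow> (nat \<Rightarrow> real) \<Rightarrow> nat \<Rightarrow> real" where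
  "gibbs n e k = exp (e k) * inverse (\<Sum>l\<le>n. exp (e l))"

lemma partition_function_pos: "(\<Sum>l\<le>(n::nat). exp (e l :: real)) > 0"
  by (intro sum_pos) auto

lemma gibbs_nonneg: "0 \<le> gibbs n e k"
  unfolding gibbs_def using partition_function_pos[of e n] by simp

lemma sum_gibbs: "(\<Sum>k\<le>n. gibbs n e k) = 1"
  unfolding gibbs_def sum_distrib_right[symmetric] using partition_function_pos[of e n] by simp

lemma gibbs_le_1: "k \<le> n \<Longrightarrow> gibbs n e k \<le> 1"
  using member_le_sum[of k "{..n}" "gibbs n e"] gibbs_nonneg[of n e] by (simp add: sum_gibbs)

text \<open>Weights of states whose energy lies below that of another state are exponentially small.\<close>

lemma gibbs_le_exp_diff: 
  assumes "m \<le> n" shows "gibbs n e k \<le> exp (e k - e m)"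
proof -
  have "gibbs n e k = exp (e k - e m) * gibbs n e m"
    by (simp add: gibbs_def exp_diff)
  also have "\<dots> \<le> exp (e k - e m) * 1"
    using gibbs_le_1[OF assms] by (intro mult_left_mono) auto
  finally show ?thesis by simp
qed

lemma gibbs_has_derivative:
  assumes "\<And>k. k \<le> n \<Longrightarrow> (e k has_real_derivative e' k) (at y)" "k \<le> n"
  shows "((\<lambda>y. gibbs n (\<lambda>k. e k y) k) has_real_derivative
    gibbs n (\<lambda>k. e k y) k * (e' k - (\<Sum>l\<le>n. gibbs n (\<lambda>k. e k y) l * e' l))) (at y)"
proof -
  let ?Z = "\<lambda>y. \<Sum>l\<le>n. exp (e l y)"
  have Z: "?Z y > 0" by (rule partition_function_pos)
  have "(?Z has_real_derivative (\<Sum>l\<le>n. exp (e l y) * e' l)) (at y)"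
    by (intro derivative_eq_intros DERIV_fun_exp assms(1)) (auto simp: assms(1))
  moreover have "((\<lambda>y. exp (e k y)) has_real_derivative exp (e k y) * e' k) (at y)"
    by (intro DERIV_fun_exp assms)
  ultimately have "((\<lambda>y. exp (e k y) * inverse (?Z y)) has_real_derivative
      exp (e k y) * (- (inverse (?Z y) * (\<Sum>l\<le>n. exp (e l y) * e' l) * inverse (?Z y)))
      + exp (e k y) * e' k * inverse (?Z y)) (at y)"
    using Z by (intro DERIV_mult' DERIV_inverse') auto
  moreover have "(\<Sum>l\<le>n. gibbs n (\<lambda>k. e k y) l * e' l)
      = inverse (?Z y) * (\<Sum>l\<le>n. exp (e l y) * e' l)"
    by (simp add: gibbs_def sum_distrib_left mult_ac)
  ultimately show ?thesis
    by (simp add: gibbs_def algebra_simps)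
qed

text \<open>The covariance of \<open>f\<close> and \<open>g\<close> under the weights \<open>w\<close>, symmetrised over pairs.  Derivatives of Gibbs
weights have exactly the centred form on the left, so every derivative of an average over the
weights turns into a sum over pairs of states.\<close>

lemma weighted_covariance:
  fixes w f g :: "nat \<Rightarrow> real"
  assumes "(\<Sum>k\<le>n. w k) = 1"
  shows "(\<Sum>k\<le>n. f k * (w k * (g k - (\<Sum>l\<le>n. w l * g l))))
       = (\<Sum>k\<le>n. \<Sum>l\<le>n. w k * w l * ((f k - f l) * (g k - g l))) / 2"
proof -
  define S where "S h = (\<Sum>k\<le>n. w k * h k)" for h
  have S: "(\<Sum>k\<le>n. \<Sum>l\<le>n. w k * w l * (h k * j l)) = S h * S j" for h j
    unfolding S_def sum_product by (simp add: mult_ac)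
  have one: "S (\<lambda>_. 1) = 1" using assms by (simp add: S_def)
  have "(\<Sum>k\<le>n. \<Sum>l\<le>n. w k * w l * ((f k - f l) * (g k - g l)))
     = (\<Sum>k\<le>n. \<Sum>l\<le>n. w k * w l * ((f k * g k) * 1)) - (\<Sum>k\<le>n. \<Sum>l\<le>n. w k * w l * (f k * g l))
      - (\<Sum>k\<le>n. \<Sum>l\<le>n. w k * w l * (g k * f l)) + (\<Sum>k\<le>n. \<Sum>l\<le>n. w k * w l * (1 * (f l * g l)))"
    unfolding sum.distrib[symmetric] sum_subtractf[symmetric]
    by (intro sum.cong refl) (simp add: algebra_simps)
  also have "\<dots> = 2 * (S (\<lambda>k. f k * g k) - S f * S g)"
    unfolding S[of "\<lambda>k. f k * g k" "\<lambda>_. 1"] S[of "\<lambda>_. 1" "\<lambda>k. f k * g k"] S one by simp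
  also have "S (\<lambda>k. f k * g k) - S f * S g = (\<Sum>k\<le>n. f k * (w k * (g k - S g)))"
  proof -
    have "(\<Sum>k\<le>n. f k * (w k * (g k - S g))) = (\<Sum>k\<le>n. w k * (f k * g k) - S g * (w k * f k))"
      by (intro sum.cong) (simp_all add: algebra_simps)
    also have "\<dots> = (\<Sum>k\<le>n. w k * (f k * g k)) - S g * (\<Sum>k\<le>n. w k * f k)"
      by (simp only: sum_subtractf sum_distrib_left)
    finally show ?thesis by (simp add: S_def mult.commute)
  qed
  finally show ?thesis by (simp add: S_def)
qed

section \<open>The flux and pairs of Kruzkov constants\<close>

locale lipschitz_flux =
  fixes \<Lambda> lam :: "real \<Rightarrow> real" and L :: real
  assumes flux_deriv: "\<And>w. w \<in> {0..1} \<Longrightarrow> (\<Lambda> has_real_derivative lam w) (at w within {0..1})"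
    and lam_lipschitz: "L-lipschitz_on {0..1} lam"
begin

definition speed_bound :: real where "speed_bound = \<bar>lam 0\<bar> + L"

definition kruzkov_flux :: "real \<Rightarrow> real \<Rightarrow> real" where
  "kruzkov_flux u c = sgn (u - c) * (\<Lambda> u - \<Lambda> c)"

lemma L_nonneg: "0 \<le> L" using lam_lipschitz lipschitz_on_nonneg by blast

lemma speed_bound_nonneg: "0 \<le> speed_bound"
  using L_nonneg by (simp add: speed_bound_def)

lemma lam_diff_le: "v \<in> {0..1} \<Longrightarrow> w \<in> {0..1} \<Longrightarrow> \<bar>lam v - lam w\<bar> \<le> L * \<bar>v - w\<bar>"
  using lipschitz_onD[OF lam_lipschitz, of v w] by (simp add: dist_real_def)

lemma abs_lam_le: 
  assumes "w \<in> {0..1}" shows "\<bar>lam w\<bar> \<le> speed_bound"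
proof -
  have "L * \<bar>w - 0\<bar> \<le> L * 1" using assms L_nonneg by (intro mult_left_mono) auto
  then show ?thesis using lam_diff_le[of w 0] assms by (auto simp: speed_bound_def)
qed

lemma flux_mvt:
  assumes "0 \<le> a" "a \<le> b" "b \<le> 1"
  obtains z where "z \<in> {a..b}" "\<Lambda> b - \<Lambda> a = lam z * (b - a)"
proof (cases "a = b")
  case False
  have "\<exists>z\<in>{a<..<b}. \<Lambda> b - \<Lambda> a = (\<lambda>h. lam z * h) (b - a)"
  proof (rule mvt_simple)
    show "a < b" using assms False by simp
    show "(\<Lambda> has_derivative (\<lambda>h. lam w * h)) (at w within {a..b})" if "a \<le> w" "w \<le> b" for w
      using flux_deriv[of w] that assms unfolding has_field_derivative_def
      by (auto intro: has_derivative_subset)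
  qed
  then obtain z where "z \<in> {a<..<b}" "\<Lambda> b - \<Lambda> a = lam z * (b - a)" by auto
  then show ?thesis by (intro that[of z]) auto
qed (use that[of a] assms in auto)

lemma flux_lipschitz:
  assumes "u \<in> {0..1}" "v \<in> {0..1}"
  shows "\<bar>\<Lambda> u - \<Lambda> v\<bar> \<le> speed_bound * \<bar>u - v\<bar>"
proof -
  have *: "\<bar>\<Lambda> b - \<Lambda> a\<bar> \<le> speed_bound * \<bar>b - a\<bar>" if h: "0 \<le> a" "a \<le> b" "b \<le> 1" for a b
  proof -
    obtain z where "z \<in> {a..b}" "\<Lambda> b - \<Lambda> a = lam z * (b - a)" using flux_mvt[OF h] by blast
    then show ?thesis
      using abs_lam_le[of z] h by (auto simp: abs_mult intro!: mult_right_mono)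
  qed
  show ?thesis
    using *[of u v] *[of v u] assms by (cases "u \<le> v") (auto simp: abs_minus_commute)
qed

lemma kruzkov_flux_le:
  assumes "u \<in> {0..1}" "c \<in> {0..1}"
  shows "\<bar>kruzkov_flux u c\<bar> \<le> speed_bound * \<bar>u - c\<bar>"
proof (cases "u = c")
  case False
  then show ?thesis
    using flux_lipschitz[OF assms] by (simp add: kruzkov_flux_def abs_mult abs_sgn_eq)
qed (simp add: kruzkov_flux_def)

text \<open>The mean value theorem on \<open>[a, u]\<close> and on \<open>[u, b]\<close> reduces the error of linear interpolation to a
difference of two values of \<open>lam\<close>.\<close>

lemma interpolation_error:
  assumes "0 \<le> a" "a \<le> u" "u \<le> b" "b \<le> 1"
  shows "(b - u) * \<Lambda> a + (u - a) * \<Lambda> b - (b - a) * \<Lambda> u \<le> (b - u) * (u - a) * (L * (b - a))"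
proof -
  obtain y where y: "y \<in> {a..u}" "\<Lambda> u - \<Lambda> a = lam y * (u - a)"
    using flux_mvt[of a u] assms by auto
  obtain z where z: "z \<in> {u..b}" "\<Lambda> b - \<Lambda> u = lam z * (b - u)"
    using flux_mvt[of u b] assms by auto
  have "(b - u) * \<Lambda> a + (u - a) * \<Lambda> b - (b - a) * \<Lambda> u
      = (u - a) * (\<Lambda> b - \<Lambda> u) - (b - u) * (\<Lambda> u - \<Lambda> a)"
    by (simp add: algebra_simps)
  also have "\<dots> = (b - u) * (u - a) * (lam z - lam y)"
    unfolding y(2) z(2) by (simp add: algebra_simps)
  also have "\<dots> \<le> (b - u) * (u - a) * (L * (b - a))"
  proof (intro mult_left_mono)
    have "lam z - lam y \<le> L * \<bar>z - y\<bar>" using lam_diff_le[of z y] y z assms by auto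
    also have "\<dots> \<le> L * (b - a)" using y z L_nonneg by (intro mult_left_mono) auto
    finally show "lam z - lam y \<le> L * (b - a)" .
  qed (use assms in auto)
  finally show ?thesis .
qed

text \<open>The contribution of a pair \<open>c, d\<close> of Kruzkov constants to the entropy production of the Gibbs
weighted Kruzkov inequality, see \<open>production_eq\<close> below.  The two terms are the summands of two
symmetrised covariances: of the entropies with the fluxes, which enters with a minus sign, and of
the entropy fluxes with the constants.\<close>

definition pair_production :: "real \<Rightarrow> real \<Rightarrow> real \<Rightarrow> real" where
  "pair_production u c d = - ((\<bar>u - c\<bar> - \<bar>u - d\<bar>) * (\<Lambda> c - \<Lambda> d))
     + (kruzkov_flux u c - kruzkov_flux u d) * (c - d)"

lemma pair_production_commute: "pair_production u c d = pair_production u d c"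
  by (simp add: pair_production_def algebra_simps)

text \<open>On either side of both constants the entropy is affine with slope \<open>1\<close> or \<open>-1\<close>, and the two terms
cancel.\<close>

lemma pair_production_outside:
  assumes "d \<le> c" "u \<le> d \<or> c \<le> u"
  shows "pair_production u c d = 0"
  using assms(2)
proof
  assume "u \<le> d"
  then show ?thesis
    using assms(1) by (cases "u = d"; cases "u = c")
      (auto simp: pair_production_def kruzkov_flux_def algebra_simps)
next
  assume "c \<le> u"
  then show ?thesis
    using assms(1) by (cases "u = d"; cases "u = c")
      (auto simp: pair_production_def kruzkov_flux_def algebra_simps)
qed

text \<open>Between the constants the pair production is, up to the factor \<open>2 * (c - d)\<close>, the height of the
chord of \<open>\<Lambda>\<close> over \<open>[d, c]\<close> above \<open>\<Lambda>\<close> at \<open>u\<close>.\<close>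

lemma pair_production_inside:
  assumes "d < u" "u < c"
  shows "pair_production u c d = 2 * ((c - u) * \<Lambda> d + (u - d) * \<Lambda> c - (c - d) * \<Lambda> u)"
  using assms by (simp add: pair_production_def kruzkov_flux_def algebra_simps)

text \<open>A bound that is quadratic in \<open>c - d\<close> turns, after averaging over pairs, into a multiple of the
variance of the Gibbs weights.\<close>

lemma pair_production_le:
  assumes "u \<in> {0..1}" "c \<in> {0..1}" "d \<in> {0..1}"
  shows "pair_production u c d \<le> 4 * speed_bound * (c - d)\<^sup>2"
proof -
  have *: "pair_production u c d \<le> 4 * speed_bound * (c - d)\<^sup>2" if "d < u" "u < c" "0 \<le> d" "c \<le> 1" for c d
  proof -
    have "pair_production u c d = 2 * ((c - u) * (\<Lambda> d - \<Lambda> u) + (u - d) * (\<Lambda> c - \<Lambda> u))"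
      unfolding pair_production_inside[OF that(1,2)] by (simp add: algebra_simps)
    also have "\<dots> \<le> 2 * ((c - u) * (speed_bound * (u - d)) + (u - d) * (speed_bound * (c - u)))"
      using that flux_lipschitz[of d u] flux_lipschitz[of c u] assms(1)
      by (intro mult_left_mono add_mono) auto
    also have "\<dots> = 4 * speed_bound * ((c - u) * (u - d))" by (simp add: algebra_simps)
    also have "\<dots> \<le> 4 * speed_bound * ((c - d) * (c - d))"
      using that speed_bound_nonneg by (intro mult_left_mono mult_mono) auto
    finally show ?thesis by (simp add: power2_eq_square)
  qed
  have nn: "0 \<le> 4 * speed_bound * (c - d)\<^sup>2" using speed_bound_nonneg by simp
  consider "d < u" "u < c" | "c < u" "u < d" | "d \<le> c" "u \<le> d \<or> c \<le> u" | "c \<le> d" "u \<le> c \<or> d \<le> u"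
    by linarith
  then show ?thesis
  proof cases
    case 2 then show ?thesis
      using *[of c d] assms by (simp add: pair_production_commute[of u c d] power2_commute[of c d])
  next
    case 4 then show ?thesis
      using pair_production_outside[of c d u] nn by (simp add: pair_production_commute[of u c d])
  qed (use * assms nn pair_production_outside in auto)
qed

text \<open>At all grid points between \<open>l / n\<close> and \<open>k / n\<close> the chord of \<open>\<Lambda>\<close> stays below \<open>\<Lambda>\<close>: Oleinik's admissibility
of the jump from \<open>l / n\<close> to \<open>k / n\<close> for the piecewise linear interpolation of \<open>\<Lambda>\<close>.  The factors
\<open>k - l\<close> are cleared, and truncated subtraction agrees with subtraction since \<open>l < m < k\<close>.\<close>

definition chord_below :: "nat \<Rightarrow> nat \<Rightarrow> nat \<Rightarrow> bool" where
  "chord_below n l k \<longleftrightarrow> (\<forall>m. l < m \<and> m < k \<longrightarrow>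
     real (k - m) * \<Lambda> (real l / real n) + real (m - l) * \<Lambda> (real k / real n)
       \<le> real (k - l) * \<Lambda> (real m / real n))"

text \<open>For an admissible jump the chord lies below the piecewise linear interpolation of \<open>\<Lambda>\<close>, and so it
exceeds \<open>\<Lambda>\<close> by at most the interpolation error on one cell of width \<open>1 / n\<close>.  The resulting bound is
linear in \<open>k - l\<close>, hence at most quadratic, because \<open>k - l\<close> is an integer.\<close>

lemma pair_production_chord_below:
  assumes "n \<ge> 1" "l < k" "k \<le> n" "chord_below n l k" "u \<in> {0..1}"
  shows "pair_production u (real k / real n) (real l / real n)
     \<le> L / (2 * real n) * (real k / real n - real l / real n)\<^sup>2"
proof (cases "real l / real n < u \<and> u < real k / real n")
  case False
  then show ?thesis
    using assms pair_production_outside[of "real l / real n" "real k / real n" u] L_nonneg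
    by (auto simp: not_less divide_right_mono)
next
  case True
  define N where "N = real n"
  have N: "N > 0" using assms by (simp add: N_def)
  \<comment> \<open>The cell \<open>[a, b]\<close> of the grid that contains \<open>u\<close>.\<close>
  define m where "m = nat \<lfloor>N * u\<rfloor>"
  have m: "real m \<le> N * u" "N * u < real m + 1"
    using assms(5) N unfolding m_def by (auto simp: of_nat_nat)
  have lk: "real l < N * u" "N * u < real k" using True N by (auto simp: N_def field_simps)
  have ml: "l \<le> m" "Suc m \<le> k"
    using m lk by linarith+
  define a b where "a = real m / N" and "b = real (Suc m) / N"
  \<comment> \<open>\<open>k - l\<close> times the chord, as an affine function that can be compared cell by cell.\<close>
  define C where "C w = (real k - N * w) * \<Lambda> (real l / N) + (N * w - real l) * \<Lambda> (real k / N)" for w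
  have Cnode: "C (real j / N) \<le> (real k - real l) * \<Lambda> (real j / N)" if "l \<le> j" "j \<le> k" for j
  proof (cases "j = l \<or> j = k")
    case True
    then show ?thesis using N by (auto simp: C_def)
  next
    case False
    then have "l < j" "j < k" using that by auto
    then show ?thesis
      using assms(4)[unfolded chord_below_def, rule_format, of j] N
      by (simp add: C_def N_def of_nat_diff)
  qed
  have ab: "a \<le> u" "u \<le> b" "0 \<le> a" "b \<le> 1" "b - a = 1 / N"
    using m N ml assms(3) by (auto simp: a_def b_def field_simps N_def)
  have err: "(b - u) * \<Lambda> a + (u - a) * \<Lambda> b - (b - a) * \<Lambda> u \<le> L / (4 * N ^ 3)"
  proof -
    have "(b - u) * \<Lambda> a + (u - a) * \<Lambda> b - (b - a) * \<Lambda> u \<le> (b - u) * (u - a) * (L * (b - a))"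
      using ab by (intro interpolation_error) 
    also have "\<dots> \<le> ((b - a)\<^sup>2 / 4) * (L * (b - a))"
    proof (intro mult_right_mono)
      have "0 \<le> ((b - u) - (u - a))\<^sup>2" by simp
      then show "(b - u) * (u - a) \<le> (b - a)\<^sup>2 / 4"
        by (simp add: power2_eq_square algebra_simps)
    qed (use ab(5) N L_nonneg in auto)
    also have "\<dots> = L / (4 * N ^ 3)" unfolding ab(5) by (simp add: field_simps power2_eq_square power3_eq_cube)
    finally show ?thesis .
  qed
  have "C u = N * ((b - u) * C a + (u - a) * C b)"
    unfolding C_def a_def b_def using N by (simp add: field_simps)
  also have "\<dots> \<le> N * ((b - u) * ((real k - real l) * \<Lambda> a) + (u - a) * ((real k - real l) * \<Lambda> b))"
    using Cnode[of m] Cnode[of "Suc m"] ml ab N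
    by (intro mult_left_mono add_mono) (auto simp: a_def b_def)
  also have "\<dots> = (real k - real l) * (N * ((b - u) * \<Lambda> a + (u - a) * \<Lambda> b))"
    by (simp add: algebra_simps)
  also have "\<dots> \<le> (real k - real l) * (N * ((b - a) * \<Lambda> u + L / (4 * N ^ 3)))"
    using err assms(2) N by (intro mult_left_mono) auto
  also have "\<dots> = (real k - real l) * (\<Lambda> u + L / (4 * N ^ 2))"
    unfolding ab(5) using N by (simp add: field_simps power2_eq_square power3_eq_cube)
  finally have Cu: "C u \<le> (real k - real l) * (\<Lambda> u + L / (4 * N ^ 2))" .
  have "pair_production u (real k / N) (real l / N) = 2 / N * (C u - (real k - real l) * \<Lambda> u)"
    using True N by (simp add: pair_production_inside N_def[symmetric] C_def field_simps)
  also have "\<dots> \<le> 2 / N * ((real k - real l) * (L / (4 * N ^ 2)))"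
    using Cu N by (intro mult_left_mono) (auto simp: algebra_simps)
  also have "\<dots> = L / (2 * N) * ((real k - real l) * 1 / N ^ 2)"
    using N by (simp add: field_simps power2_eq_square)
  also have "\<dots> \<le> L / (2 * N) * ((real k - real l) * (real k - real l) / N ^ 2)"
    using assms(2) N L_nonneg by (intro mult_left_mono divide_right_mono) auto
  also have "\<dots> = L / (2 * N) * (real k / N - real l / N)\<^sup>2"
    using N by (simp add: field_simps power2_eq_square)
  finally show ?thesis by (simp add: N_def)
qed

text \<open>There are finitely many triples of grid points, so one gap \<open>\<kappa>\<close> serves all jumps that are not
admissible.\<close>

lemma chord_gap:
  obtains \<kappa> where "\<kappa> > 0" 
    "\<And>l k. \<lbrakk>l < k; k \<le> n; \<not> chord_below n l k\<rbrakk> \<Longrightarrow> \<exists>m. l < m \<and> m < k \<and>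
      real (k - l) * (\<Lambda> (real m / real n) + \<kappa>)
      \<le> real (k - m) * \<Lambda> (real l / real n) + real (m - l) * \<Lambda> (real k / real n)"
proof -
  define gap where "gap = (\<lambda>(l, m, k). (real (k - m) * \<Lambda> (real l / real n) + real (m - l) * \<Lambda> (real k / real n)
     - real (k - l) * \<Lambda> (real m / real n)) / real (k - l))"
  define T where "T = {(l, m, k). l < m \<and> m < k \<and> k \<le> n \<and> gap (l, m, k) > 0}"
  have fin: "finite T" by (rule finite_subset[of _ "{..n} \<times> {..n} \<times> {..n}"]) (auto simp: T_def)
  define \<kappa> where "\<kappa> = Min (insert 1 (gap ` T))"
  have "\<kappa> > 0" unfolding \<kappa>_def using fin by (subst Min_gr_iff) (auto simp: T_def)
  moreover have "\<exists>m. l < m \<and> m < k \<and>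
      real (k - l) * (\<Lambda> (real m / real n) + \<kappa>)
      \<le> real (k - m) * \<Lambda> (real l / real n) + real (m - l) * \<Lambda> (real k / real n)"
    if lk: "l < k" "k \<le> n" "\<not> chord_below n l k" for l k
  proof -
    obtain m where m: "l < m" "m < k" "real (k - m) * \<Lambda> (real l / real n) + real (m - l) * \<Lambda> (real k / real n)
       > real (k - l) * \<Lambda> (real m / real n)"
      using lk unfolding chord_below_def by (auto simp: not_le)
    then have "(l, m, k) \<in> T" using lk by (auto simp: T_def gap_def)
    then have "\<kappa> \<le> gap (l, m, k)" unfolding \<kappa>_def using fin by (intro Min_le) auto
    then have "real (k - l) * \<kappa> \<le> real (k - l) * gap (l, m, k)" by (intro mult_left_mono) auto
    then show ?thesis using m lk by (intro exI[of _ m]) (auto simp: gap_def distrib_left)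
  qed
  ultimately show ?thesis by (rule that)
qed

end

section \<open>Sticky positions as a maximisation problem\<close>

lemma sublevel_of_mono:
  fixes a :: "nat \<Rightarrow> real"
  assumes "mono_on {1..n} a"
  shows "{k \<in> {1..n}. a k \<le> y} = {1..card {k \<in> {1..n}. a k \<le> y}}"
proof -
  let ?A = "{k \<in> {1..n}. a k \<le> y}"
  show ?thesis
  proof (cases "?A = {}")
    case False
    define m where "m = Max ?A"
    have m: "m \<in> ?A" unfolding m_def using False by (intro Max_in) auto
    have "k \<in> ?A" if "k \<in> {1..m}" for k
      using monotone_onD[OF assms, of k m] that m by force
    moreover have "k \<le> m" if "k \<in> ?A" for k unfolding m_def using that by (intro Max_ge) auto
    moreover have "1 \<le> k" if "k \<in> ?A" for k using that by simp
    ultimately have "?A = {1..m}" by (metis (no_types, lifting) atLeastAtMost_iff subsetI subset_antisym)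
    then show ?thesis by simp
  qed simp
qed

text \<open>The partial sums of \<open>y - a j\<close> increase as long as \<open>a j < y\<close> and decrease afterwards.\<close>

lemma partial_sums_argmax:
  fixes a :: "nat \<Rightarrow> real"
  assumes mono: "mono_on {1..n} a" and y: "y \<notin> a ` {1..n}"
    and K: "K = card {k \<in> {1..n}. a k \<le> y}" and k: "k \<le> n" "k \<noteq> K"
  shows "(\<Sum>j=1..k. y - a j) < (\<Sum>j=1..K. y - a j)"
proof -
  have A: "{k \<in> {1..n}. a k \<le> y} = {1..K}"
    unfolding K by (rule sublevel_of_mono[OF mono])
  have pos: "y - a j > 0" if "j \<in> {1..K}" for j
  proof -
    have "j \<in> {k \<in> {1..n}. a k \<le> y}" using that A by simp
    then have "a j \<le> y" "a j \<noteq> y" using y by auto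
    then show ?thesis by simp
  qed
  have neg: "y - a j < 0" if "j \<in> {1..n}" "K < j" for j
  proof -
    have "j \<notin> {k \<in> {1..n}. a k \<le> y}" using that(2) A by simp
    then show ?thesis using that(1) by simp
  qed
  consider "k < K" | "K < k" using k by linarith
  then show ?thesis
  proof cases
    case 1
    then have "(\<Sum>j=1..K. y - a j) = (\<Sum>j=1..k. y - a j) + (\<Sum>j=Suc k..K. y - a j)"
      using sum.ub_add_nat[of 1 k "\<lambda>j. y - a j" "K - k"] by simp
    moreover have "(\<Sum>j=Suc k..K. y - a j) > 0"
      using 1 pos by (intro sum_pos) auto
    ultimately show ?thesis by simp
  next
    case 2
    then have "(\<Sum>j=1..k. y - a j) = (\<Sum>j=1..K. y - a j) + (\<Sum>j=Suc K..k. y - a j)"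
      using sum.ub_add_nat[of 1 K "\<lambda>j. y - a j" "k - K"] by simp
    moreover have "(\<Sum>j=Suc K..k. a j - y) > 0"
      using 2 neg by (intro sum_pos) (use k in auto)
    then have "(\<Sum>j=Suc K..k. y - a j) < 0"
      by (simp add: sum_subtractf)
    ultimately show ?thesis by simp
  qed
qed

lemma gcm_ge:
  assumes "convex_on {0..1} h" "\<And>z. z \<in> {0..1} \<Longrightarrow> h z \<le> Q z" "w \<in> {0..1}"
  shows "h w \<le> greatest_convex_minorant Q w"
  unfolding greatest_convex_minorant_def
  using assms by (intro cSup_upper) (auto intro!: bdd_aboveI[of _ "Q w"])

lemma gcm_least:
  assumes "convex_on {0..1} h" "\<And>z. z \<in> {0..1} \<Longrightarrow> h z \<le> Q z"
    and "\<And>g. convex_on {0..1} g \<Longrightarrow> (\<And>z. z \<in> {0..1} \<Longrightarrow> g z \<le> Q z) \<Longrightarrow> g w \<le> B"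
  shows "greatest_convex_minorant Q w \<le> B"
  unfolding greatest_convex_minorant_def
  using assms by (intro cSup_least) auto

lemma gcm_le:
  assumes "convex_on {0..1} h" "\<And>z. z \<in> {0..1} \<Longrightarrow> h z \<le> Q z" "w \<in> {0..1}"
  shows "greatest_convex_minorant Q w \<le> Q w"
  using assms by (intro gcm_least[of h]) auto

lemma gcm_midpoint:
  assumes "convex_on {0..1} h" "\<And>z. z \<in> {0..1} \<Longrightarrow> h z \<le> Q z" "a \<in> {0..1}" "b \<in> {0..1}"
  shows "greatest_convex_minorant Q ((a + b) / 2)
    \<le> (greatest_convex_minorant Q a + greatest_convex_minorant Q b) / 2"
proof (rule gcm_least[OF assms(1,2)])
  fix g assume g: "convex_on {0..1} g" "\<And>z. z \<in> {0..1} \<Longrightarrow> g z \<le> Q z"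
  have "g ((1 - 1/2) *\<^sub>R a + (1/2) *\<^sub>R b) \<le> (1 - 1/2) * g a + (1/2) * g b"
    using assms by (intro convex_onD[OF g(1)]) auto
  moreover have "g a \<le> greatest_convex_minorant Q a" "g b \<le> greatest_convex_minorant Q b"
    using g assms by (auto intro: gcm_ge)
  ultimately show "g ((a + b) / 2) \<le> (greatest_convex_minorant Q a + greatest_convex_minorant Q b) / 2"
    by (simp add: add_divide_distrib)
qed auto

lemma affine_convex_on: "convex_on {0..1} (\<lambda>w::real. c + d * w)"
  by (intro convex_onI) (auto simp: algebra_simps)

text \<open>On a cell of the grid the interpolation is a convex combination of its two nodal values, so an
affine minorant need only be tested at the nodes.\<close>

lemma affine_le_free_interp:
  assumes n: "n \<ge> 1"
    and nodes: "\<And>k. k \<le> n \<Longrightarrow> c + d * (real k / real n) \<le> free_interp n v x t (real k / real n)"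
    and w: "w \<in> {0..1}"
  shows "c + d * w \<le> free_interp n v x t w"
proof -
  define k where "k = min (n - 1) (nat \<lfloor>real n * w\<rfloor>)"
  define \<theta> where "\<theta> = real n * w - real k"
  have "real k \<le> real n * w" "real n * w \<le> real k + 1" "k < n"
  proof -
    have nw: "0 \<le> real n * w" "real n * w \<le> real n" using w n by (auto simp: mult_left_le)
    have f: "real (nat \<lfloor>real n * w\<rfloor>) \<le> real n * w" "real n * w < real (nat \<lfloor>real n * w\<rfloor>) + 1"
      using nw by (auto simp: of_nat_nat)
    then show "real k \<le> real n * w" unfolding k_def by (auto simp: min_def)
    show "real n * w \<le> real k + 1" using f nw n unfolding k_def by (auto simp: min_def of_nat_diff)
    show "k < n" using n by (simp add: k_def)
  qed
  then have th: "0 \<le> \<theta>" "\<theta> \<le> 1" "Suc k \<le> n" "k \<le> n" by (auto simp: \<theta>_def)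
  let ?cl = "\<lambda>j w. max 0 (min 1 (real n * w - (real j - 1)))"
  have wk: "real n * w = real k + \<theta>" by (simp add: \<theta>_def)
  have cl: "?cl j w = (1 - \<theta>) * ?cl j (real k / real n) + \<theta> * ?cl j (real (Suc k) / real n)" for j
  proof -
    have e: "real n * (real k / real n) = real k" "real n * (real (Suc k) / real n) = real k + 1"
      using n by auto
    consider "real j \<le> real k" | "j = Suc k" | "real k + 2 \<le> real j" by linarith
    then show ?thesis
    proof cases
      case 1
      then have "?cl j w = 1" "?cl j (real k / real n) = 1" "?cl j (real (Suc k) / real n) = 1"
        unfolding e wk using th by (simp_all add: min_def max_def)
      then show ?thesis by simp
    next
      case 2
      then have "?cl j w = \<theta>" "?cl j (real k / real n) = 0" "?cl j (real (Suc k) / real n) = 1"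
        unfolding e wk using th by (simp_all add: min_def max_def)
      then show ?thesis by simp
    next
      case 3
      then have "?cl j w = 0" "?cl j (real k / real n) = 0" "?cl j (real (Suc k) / real n) = 0"
        unfolding e wk using th by (simp_all add: min_def max_def)
      then show ?thesis by simp
    qed
  qed
  have "free_interp n v x t w = (1 - \<theta>) * free_interp n v x t (real k / real n)
      + \<theta> * free_interp n v x t (real (Suc k) / real n)"
    unfolding free_interp_def cl sum_distrib_left sum.distrib[symmetric]
    by (intro sum.cong refl) (simp only: algebra_simps)
  also have "\<dots> \<ge> (1 - \<theta>) * (c + d * (real k / real n)) + \<theta> * (c + d * (real (Suc k) / real n))"
    using th by (intro add_mono mult_left_mono nodes) auto
  also have "(1 - \<theta>) * (c + d * (real k / real n)) + \<theta> * (c + d * (real (Suc k) / real n)) = c + d * w"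
  proof -
    have "w = (real k + \<theta>) / real n" using wk n by (simp add: field_simps)
    then show ?thesis using n by (simp add: field_simps)
  qed
  finally show ?thesis .
qed

text \<open>The supporting line of slope \<open>y\<close> (per particle): the highest such line below the nodes, touching
at the node \<open>k\<close>.\<close>

lemma affine_minorant_exists:
  assumes n: "n \<ge> 1"
  obtains \<alpha> k where "k \<le> n" "\<alpha> = (\<Sum>j=1..k. x j + t * v j) - real k * y"
    "\<And>k. k \<le> n \<Longrightarrow> \<alpha> \<le> (\<Sum>j=1..k. x j + t * v j) - real k * y"
    "\<And>w. w \<in> {0..1} \<Longrightarrow> \<alpha> + (real n * y) * w \<le> free_interp n v x t w"
proof -
  let ?g = "\<lambda>k. (\<Sum>j=1..k. x j + t * v j) - real k * y"
  define \<alpha> where "\<alpha> = Min (?g ` {..n})"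
  have "\<alpha> \<in> ?g ` {..n}" unfolding \<alpha>_def by (intro Min_in) auto
  then obtain k where k: "k \<le> n" "\<alpha> = ?g k" by auto
  have le: "\<alpha> \<le> ?g k" if "k \<le> n" for k unfolding \<alpha>_def using that by (intro Min_le) auto
  have "\<alpha> + (real n * y) * w \<le> free_interp n v x t w" if "w \<in> {0..1}" for w
  proof (rule affine_le_free_interp[OF n _ that])
    fix k assume "k \<le> n"
    then show "\<alpha> + real n * y * (real k / real n) \<le> free_interp n v x t (real k / real n)"
      using n le[of k] by (simp add: free_interp_node mult.commute)
  qed
  with k le show ?thesis by (intro that[of k \<alpha>]) auto
qed

lemma sticky_position_mono:
  assumes "n \<ge> 1"
  shows "mono_on {1..n} (sticky_position n v x t)"
proof -
  let ?g = "greatest_convex_minorant (free_interp n v x t)"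
  obtain \<alpha> where min: "\<And>w. w \<in> {0..1} \<Longrightarrow> \<alpha> + (real n * 0) * w \<le> free_interp n v x t w"
    by (rule affine_minorant_exists[OF assms, of x t v 0]) blast
  have adj: "sticky_position n v x t k \<le> sticky_position n v x t (Suc k)" if "1 \<le> k" "Suc k \<le> n" for k
  proof -
    have "?g (((real k - 1) / real n + real (Suc k) / real n) / 2)
        \<le> (?g ((real k - 1) / real n) + ?g (real (Suc k) / real n)) / 2"
      using that by (intro gcm_midpoint[OF affine_convex_on min]) (auto simp: field_simps)
    moreover have "((real k - 1) / real n + real (Suc k) / real n) / 2 = real k / real n"
      using assms by (simp add: field_simps)
    ultimately show ?thesis by (simp add: sticky_position_def)
  qed
  show ?thesis
  proof (intro monotone_onI)
    fix i j assume ij: "i \<in> {1..n}" "j \<in> {1..n}" "i \<le> j"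
    from ij(3) show "sticky_position n v x t i \<le> sticky_position n v x t j"
      using ij(1,2)
    proof (induction j rule: dec_induct)
      case (step m)
      then show ?case using adj[of m] by simp
    qed simp
  qed
qed

text \<open>The number of sticky particles to the left of \<open>y\<close> maximises the concave nodal functional of the
freely moving particles.  This is Legendre duality: a function and its greatest convex minorant
have the same supporting lines, and the minorant's supporting line of slope \<open>y\<close> touches it exactly
where its increments, the sticky positions, pass \<open>y\<close>.\<close>

lemma sticky_argmax:
  assumes n: "n \<ge> 1" and y: "y \<notin> sticky_position n v x t ` {1..n}"
    and K: "K = card {k \<in> {1..n}. sticky_position n v x t k \<le> y}" and k: "k \<le> n" "k \<noteq> K"
  shows "real k * y - (\<Sum>j=1..k. x j + t * v j) < real K * y - (\<Sum>j=1..K. x j + t * v j)"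
proof -
  let ?g = "greatest_convex_minorant (free_interp n v x t)"
  let ?S = "\<lambda>k. \<Sum>j=1..k. x j + t * v j"
  have "K \<le> card {1..n}"
    unfolding K by (intro card_mono) auto
  then have Kn: "K \<le> n" by simp
  obtain \<alpha> m where m: "m \<le> n" "\<alpha> = ?S m - real m * y"
    and le: "\<And>k. k \<le> n \<Longrightarrow> \<alpha> \<le> ?S k - real k * y"
    and min: "\<And>w. w \<in> {0..1} \<Longrightarrow> \<alpha> + (real n * y) * w \<le> free_interp n v x t w"
    by (rule affine_minorant_exists[OF n, of x t v y]) blast
  have tele: "(\<Sum>j=1..k. y - sticky_position n v x t j) = real k * y - ?g (real k / real n) + ?g 0" for k
    by (induction k) (auto simp: sticky_position_def algebra_simps)
  \<comment> \<open>A touching node \<open>j\<close> of the line minimises the minorant minus the line, and \<open>K\<close> is the only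
    such minimiser by the monotonicity of the sticky positions.\<close>
  have unique: "j = K" if j: "j \<le> n" "\<alpha> = ?S j - real j * y" for j
  proof (rule ccontr)
    assume "j \<noteq> K"
    then have "real j * y - ?g (real j / real n) < real K * y - ?g (real K / real n)"
      using partial_sums_argmax[OF sticky_position_mono[OF n] y K j(1)] unfolding tele by simp
    moreover have "?g (real j / real n) \<le> ?S j"
      using gcm_le[OF affine_convex_on min, of "real j / real n"] j n by (simp add: free_interp_node)
    moreover have "\<alpha> + real K * y \<le> ?g (real K / real n)"
      using gcm_ge[OF affine_convex_on min, of "real K / real n"] Kn n by (simp add: mult.commute)
    ultimately show False using j(2) by simp
  qed
  from unique[OF m] m(2) have "\<alpha> = ?S K - real K * y" by simp
  moreover have "\<alpha> < ?S k - real k * y"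
    using le[OF k(1)] unique[of k] k by fastforce
  ultimately show ?thesis by simp
qed

lemma sticky_cdf_eq_card:
  "sticky_cdf lam n x t y
     = real (card {k \<in> {1..n}. sticky_position n (mean_velocity lam n) x t k \<le> y}) / real n"
proof -
  have "(\<Sum>k=1..n. indicator {..y} (sticky_position n (mean_velocity lam n) x t k) :: real)
     = (\<Sum>k\<in>{k \<in> {1..n}. sticky_position n (mean_velocity lam n) x t k \<le> y}. 1)"
    by (intro sum.mono_neutral_cong_right) (auto simp: indicator_def)
  then show ?thesis by (simp add: sticky_cdf_def)
qed

lemma cdf_empirical_measure:
  assumes "n \<ge> 1"
  shows "cdf (empirical_measure n x) y = real (card {k \<in> {1..n}. x k \<le> y}) / real n"
proof -
  have "cdf (empirical_measure n x) y = measure (uniform_count_measure {1..n}) (x -` {..y} \<inter> {1..n})"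
    unfolding cdf_def empirical_measure_def by (subst measure_distr) (auto simp: space_uniform_count_measure)
  also have "x -` {..y} \<inter> {1..n} = {k \<in> {1..n}. x k \<le> y}" by auto
  also have "measure (uniform_count_measure {1..n}) {k \<in> {1..n}. x k \<le> y}
      = real (card {k \<in> {1..n}. x k \<le> y}) / real (card {1..n})"
    by (rule measure_uniform_count_measure) auto
  finally show ?thesis by simp
qed

lemma (in lipschitz_flux) mean_velocity_eq:
  assumes "n \<ge> 1" "k \<in> {1..n}"
  shows "mean_velocity lam n k = real n * (\<Lambda> (real k / real n) - \<Lambda> ((real k - 1) / real n))"
proof -
  let ?a = "(real k - 1) / real n" and ?b = "real k / real n"
  have ab: "?a \<le> ?b" "0 \<le> ?a" "?b \<le> 1" using assms by (auto simp: field_simps)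
  have "continuous_on {?a..?b} lam"
    using lipschitz_on_continuous_on[OF lam_lipschitz] ab by (auto intro: continuous_on_subset)
  then have "integral\<^sup>L lborel (\<lambda>w. indicator {?a..?b} w *\<^sub>R lam w) = \<Lambda> ?b - \<Lambda> ?a"
    using ab
    by (intro integral_FTC_Icc)
       (auto simp flip: has_real_derivative_iff_has_vector_derivative intro!: has_field_derivative_subset[OF flux_deriv])
  then show ?thesis by (simp add: mean_velocity_def set_lebesgue_integral_def)
qed

lemma (in lipschitz_flux) sum_mean_velocity:
  assumes "n \<ge> 1" "k \<le> n"
  shows "(\<Sum>j=1..k. mean_velocity lam n j) = real n * (\<Lambda> (real k / real n) - \<Lambda> 0)"
  using assms(2)
  by (induction k) (auto simp: mean_velocity_eq[OF assms(1)] algebra_simps)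

section \<open>The Gibbs approximation of the sticky particle solution\<close>

locale sticky_setting = lipschitz_flux +
  fixes n :: nat and x :: "nat \<Rightarrow> real"
  assumes n_pos: "n \<ge> 1" and x_mono: "mono_on {1..n} x"
begin

abbreviation node :: "nat \<Rightarrow> real" where "node k \<equiv> real k / real n"

text \<open>The energies are affine in time and space.  The potential at \<open>k\<close>, a partial sum of the initial
positions, is convex in \<open>k\<close> because the positions are ordered.  Up to the factor \<open>n\<close> and a summand
independent of \<open>k\<close>, which no Gibbs weight sees, \<open>energy t y k\<close> is the functional maximised in
\<open>sticky_argmax\<close>.\<close>

definition energy :: "real \<Rightarrow> real \<Rightarrow> nat \<Rightarrow> real" where
  "energy t y k = node k * y - (\<Sum>j=1..k. x j) / real n - t * \<Lambda> (node k)"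

text \<open>As the temperature \<open>\<epsilon>\<close> tends to \<open>0\<close> the weights concentrate on the maximiser of the energy.\<close>

definition weight :: "real \<Rightarrow> real \<Rightarrow> real \<Rightarrow> nat \<Rightarrow> real" where
  "weight \<epsilon> t y = gibbs n (\<lambda>k. energy t y k / \<epsilon>)"

text \<open>The partial derivatives of \<open>weight\<close> in closed form, and the spatial derivative of the average of
the grid points \<open>node k\<close> under these weights.\<close>

definition weight_t :: "real \<Rightarrow> real \<Rightarrow> real \<Rightarrow> nat \<Rightarrow> real" where
  "weight_t \<epsilon> t y k = weight \<epsilon> t y k
     * (- \<Lambda> (node k) / \<epsilon> - (\<Sum>l\<le>n. weight \<epsilon> t y l * (- \<Lambda> (node l) / \<epsilon>)))"

definition weight_x :: "real \<Rightarrow> real \<Rightarrow> real \<Rightarrow> nat \<Rightarrow> real" where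
  "weight_x \<epsilon> t y k = weight \<epsilon> t y k * (node k / \<epsilon> - (\<Sum>l\<le>n. weight \<epsilon> t y l * (node l / \<epsilon>)))"

definition mean_x :: "real \<Rightarrow> real \<Rightarrow> real \<Rightarrow> real" where
  "mean_x \<epsilon> t y = (\<Sum>k\<le>n. node k * weight_x \<epsilon> t y k)"

text \<open>What remains of the sum over \<open>k\<close> of the Kruzkov inequalities with constant \<open>node k\<close>, when all
derivatives fall on the weights and \<open>u\<close> is the value of the solution.\<close>

definition production :: "real \<Rightarrow> real \<Rightarrow> real \<Rightarrow> real \<Rightarrow> real" where
  "production \<epsilon> t y u =
     (\<Sum>k\<le>n. \<bar>u - node k\<bar> * weight_t \<epsilon> t y k + kruzkov_flux u (node k) * weight_x \<epsilon> t y k)"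

lemma node_in: "k \<le> n \<Longrightarrow> node k \<in> {0..1}"
  using n_pos by (auto simp: divide_le_eq_1)

lemma weight_nonneg: "0 \<le> weight \<epsilon> t y k"
  by (simp add: weight_def gibbs_nonneg)

lemma weight_le_1: "k \<le> n \<Longrightarrow> weight \<epsilon> t y k \<le> 1"
  by (simp add: weight_def gibbs_le_1)

lemma sum_weight: "(\<Sum>k\<le>n. weight \<epsilon> t y k) = 1"
  by (simp add: weight_def sum_gibbs)

lemma smooth_plane_weight: "smooth_plane (\<lambda>t y. weight \<epsilon> t y k)"
proof -
  have "smooth_plane (\<lambda>t y. exp (- \<Lambda> (node k) / \<epsilon> * t + node k / \<epsilon> * y + - ((\<Sum>j=1..k. x j) / real n) / \<epsilon>))" for k
    by (intro smooth_plane_compose_affine smooth_line_exp)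
  moreover have "- \<Lambda> (node k) / \<epsilon> * t + node k / \<epsilon> * y + - ((\<Sum>j=1..k. x j) / real n) / \<epsilon> = energy t y k / \<epsilon>" for k t y
    by (simp add: energy_def diff_divide_distrib)
  ultimately have e: "smooth_plane (\<lambda>t y. exp (energy t y k / \<epsilon>))" for k by simp
  have "(\<Sum>l\<le>n. exp (energy t y l / \<epsilon>)) \<noteq> 0" for t y
    using partition_function_pos[of "\<lambda>l. energy t y l / \<epsilon>" n] by simp
  then show ?thesis
    unfolding weight_def gibbs_def
    by (intro smooth_plane_mult smooth_plane_inverse smooth_plane_sum e) auto
qed

lemma weight_has_derivative_t:
  assumes "k \<le> n"
  shows "((\<lambda>t. weight \<epsilon> t y k) has_real_derivative weight_t \<epsilon> t y k) (at t)"
  unfolding weight_def weight_t_def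
  unfolding energy_def
  by (rule gibbs_has_derivative[OF DERIV_cdivide assms])
     (use n_pos in \<open>auto intro!: derivative_eq_intros\<close>)

lemma weight_has_derivative_x:
  assumes "k \<le> n"
  shows "((\<lambda>y. weight \<epsilon> t y k) has_real_derivative weight_x \<epsilon> t y k) (at y)"
  unfolding weight_def weight_x_def
  unfolding energy_def
  by (rule gibbs_has_derivative[OF DERIV_cdivide assms])
     (use n_pos in \<open>auto intro!: derivative_eq_intros\<close>)

lemma mean_has_derivative_x:
  "((\<lambda>y. \<Sum>k\<le>n. node k * weight \<epsilon> t y k) has_real_derivative mean_x \<epsilon> t y) (at y)"
  unfolding mean_x_def
  by (intro DERIV_sum DERIV_cmult weight_has_derivative_x) auto

text \<open>The spatial derivative of the average is the variance divided by \<open>\<epsilon>\<close>; in particular the average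
increases in space.\<close>

lemma mean_x_eq:
  "mean_x \<epsilon> t y
     = (\<Sum>k\<le>n. \<Sum>l\<le>n. weight \<epsilon> t y k * weight \<epsilon> t y l * (node k - node l)\<^sup>2) / (2 * \<epsilon>)"
proof -
  have "mean_x \<epsilon> t y = (\<Sum>k\<le>n. \<Sum>l\<le>n. weight \<epsilon> t y k * weight \<epsilon> t y l
       * ((node k - node l) * (node k / \<epsilon> - node l / \<epsilon>))) / 2"
    unfolding mean_x_def weight_x_def by (rule weighted_covariance[OF sum_weight])
  also have "\<dots> = (\<Sum>k\<le>n. \<Sum>l\<le>n. weight \<epsilon> t y k * weight \<epsilon> t y l * (node k - node l)\<^sup>2 / (2 * \<epsilon>))"
  proof -
    have "a * ((c - d) * (c / \<epsilon> - d / \<epsilon>)) / 2 = a * (c - d)\<^sup>2 / (2 * \<epsilon>)" for a c d :: real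
      by (simp add: power2_eq_square diff_divide_distrib[symmetric])
    then show ?thesis by (simp only: sum_divide_distrib)
  qed
  finally show ?thesis by (simp only: sum_divide_distrib)
qed

lemma mean_x_nonneg: "\<epsilon> > 0 \<Longrightarrow> 0 \<le> mean_x \<epsilon> t y"
  unfolding mean_x_eq by (intro divide_nonneg_pos sum_nonneg mult_nonneg_nonneg weight_nonneg) auto

lemma production_eq:
  "production \<epsilon> t y u = (\<Sum>k\<le>n. \<Sum>l\<le>n. weight \<epsilon> t y k * weight \<epsilon> t y l
      * pair_production u (node k) (node l)) / (2 * \<epsilon>)"
proof -
  let ?w = "weight \<epsilon> t y"
  have "(\<Sum>k\<le>n. \<bar>u - node k\<bar> * weight_t \<epsilon> t y k) = (\<Sum>k\<le>n. \<Sum>l\<le>n. ?w k * ?w l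
      * ((\<bar>u - node k\<bar> - \<bar>u - node l\<bar>) * (- \<Lambda> (node k) / \<epsilon> - - \<Lambda> (node l) / \<epsilon>))) / 2"
    unfolding weight_t_def by (rule weighted_covariance[OF sum_weight])
  moreover have "(\<Sum>k\<le>n. kruzkov_flux u (node k) * weight_x \<epsilon> t y k) = (\<Sum>k\<le>n. \<Sum>l\<le>n. ?w k * ?w l
      * ((kruzkov_flux u (node k) - kruzkov_flux u (node l)) * (node k / \<epsilon> - node l / \<epsilon>))) / 2"
    unfolding weight_x_def by (rule weighted_covariance[OF sum_weight])
  moreover have "?w k * ?w l * pair_production u (node k) (node l) / (2 * \<epsilon>)
     = ?w k * ?w l * ((\<bar>u - node k\<bar> - \<bar>u - node l\<bar>) * (- \<Lambda> (node k) / \<epsilon> - - \<Lambda> (node l) / \<epsilon>)) / 2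
     + ?w k * ?w l * ((kruzkov_flux u (node k) - kruzkov_flux u (node l)) * (node k / \<epsilon> - node l / \<epsilon>)) / 2"
    for k l
    by (cases "\<epsilon> = 0") (simp_all add: pair_production_def field_simps)
  ultimately show ?thesis
    by (simp add: production_def sum.distrib sum_divide_distrib)
qed

lemma production_le_mean_x:
  assumes "\<epsilon> > 0" "u \<in> {0..1}"
  shows "production \<epsilon> t y u \<le> 4 * speed_bound * mean_x \<epsilon> t y"
proof -
  have "(\<Sum>k\<le>n. \<Sum>l\<le>n. weight \<epsilon> t y k * weight \<epsilon> t y l * pair_production u (node k) (node l))
    \<le> (\<Sum>k\<le>n. \<Sum>l\<le>n. weight \<epsilon> t y k * weight \<epsilon> t y l * (4 * speed_bound * (node k - node l)\<^sup>2))"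
    by (intro sum_mono mult_left_mono pair_production_le mult_nonneg_nonneg weight_nonneg assms node_in) auto
  also have "\<dots> = 4 * speed_bound * (\<Sum>k\<le>n. \<Sum>l\<le>n. weight \<epsilon> t y k * weight \<epsilon> t y l * (node k - node l)\<^sup>2)"
    by (simp add: sum_distrib_left mult_ac)
  finally have "production \<epsilon> t y u \<le> 4 * speed_bound
      * (\<Sum>k\<le>n. \<Sum>l\<le>n. weight \<epsilon> t y k * weight \<epsilon> t y l * (node k - node l)\<^sup>2) / (2 * \<epsilon>)"
    unfolding production_eq using assms(1) by (intro divide_right_mono) auto
  then show ?thesis unfolding mean_x_eq by simp
qed

lemma initial_potential_convex:
  assumes "l < m" "m < k" "k \<le> n"
  shows "real (k - l) * (\<Sum>j=1..m. x j) \<le> real (k - m) * (\<Sum>j=1..l. x j) + real (m - l) * (\<Sum>j=1..k. x j)"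
proof -
  have 1: "(\<Sum>j=1..m. x j) = (\<Sum>j=1..l. x j) + (\<Sum>j=Suc l..m. x j)"
    using sum.ub_add_nat[of 1 l x "m - l"] assms by simp
  have 2: "(\<Sum>j=1..k. x j) = (\<Sum>j=1..m. x j) + (\<Sum>j=Suc m..k. x j)"
    using sum.ub_add_nat[of 1 m x "k - m"] assms by simp
  have "(\<Sum>j=Suc l..m. x j) \<le> (\<Sum>j=Suc l..m. x m)"
    using assms by (intro sum_mono monotone_onD[OF x_mono]) auto
  then have a: "(\<Sum>j=Suc l..m. x j) \<le> real (m - l) * x m" using assms by simp
  have "(\<Sum>j=Suc m..k. x m) \<le> (\<Sum>j=Suc m..k. x j)"
    using assms by (intro sum_mono monotone_onD[OF x_mono]) auto
  then have b: "real (k - m) * x m \<le> (\<Sum>j=Suc m..k. x j)" using assms by simp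
  have "real (k - m) * (\<Sum>j=Suc l..m. x j) \<le> real (k - m) * (real (m - l) * x m)"
    by (intro mult_left_mono a) auto
  also have "\<dots> = real (m - l) * (real (k - m) * x m)" by simp
  also have "\<dots> \<le> real (m - l) * (\<Sum>j=Suc m..k. x j)"
    by (intro mult_left_mono b) auto
  finally have c: "real (k - m) * (\<Sum>j=Suc l..m. x j) \<le> real (m - l) * (\<Sum>j=Suc m..k. x j)" .
  have "real (k - l) = real (k - m) + real (m - l)" using assms by simp
  then show ?thesis using c unfolding 2 1 by (simp add: algebra_simps)
qed

text \<open>If some grid point \<open>m\<close> violates the admissibility of the jump from \<open>l\<close> to \<open>k\<close>, a rarefaction opens:
since the potential is convex, the energy at \<open>m\<close> exceeds the corresponding convex combination of
the energies at \<open>l\<close> and \<open>k\<close> by at least \<open>t * \<kappa>\<close>, so \<open>l\<close> and \<open>k\<close> do not both carry weight.\<close>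

lemma min_weight_le:
  assumes "l < m" "m < k" "k \<le> n" "\<epsilon> > 0" "t \<ge> 0"
    and gap: "real (k - l) * (\<Lambda> (node m) + \<kappa>) \<le> real (k - m) * \<Lambda> (node l) + real (m - l) * \<Lambda> (node k)"
  shows "weight \<epsilon> t y k * weight \<epsilon> t y l \<le> exp (- (t * \<kappa> / \<epsilon>))"
proof -
  let ?e = "energy t y" and ?w = "weight \<epsilon> t y"
  let ?X = "\<lambda>k. (\<Sum>j=1..k. x j) / real n"
  have kl: "real (k - l) = real (k - m) + real (m - l)" "real (k - l) > 0" using assms by auto
  have nodes: "real (k - l) * node m = real (k - m) * node l + real (m - l) * node k"
    using assms n_pos by (simp add: of_nat_diff field_simps)
  have pot: "real (k - l) * ?X m \<le> real (k - m) * ?X l + real (m - l) * ?X k"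
    using divide_right_mono[OF initial_potential_convex[OF assms(1-3)], of "real n"]
    by (simp add: add_divide_distrib)
  have "real (k - m) * ?e l + real (m - l) * ?e k + real (k - l) * (t * \<kappa>)
      = (real (k - m) * node l + real (m - l) * node k) * y - (real (k - m) * ?X l + real (m - l) * ?X k)
        - t * (real (k - m) * \<Lambda> (node l) + real (m - l) * \<Lambda> (node k) - real (k - l) * \<kappa>)"
    unfolding energy_def by (simp add: algebra_simps)
  also have "\<dots> \<le> (real (k - l) * node m) * y - real (k - l) * ?X m - t * (real (k - l) * \<Lambda> (node m))"
    unfolding nodes using pot gap assms(5) by (intro diff_mono mult_left_mono) (auto simp: algebra_simps)
  also have "\<dots> = real (k - l) * ?e m" unfolding energy_def by (simp add: algebra_simps)
  finally have main: "real (k - m) * ?e l + real (m - l) * ?e k + real (k - l) * (t * \<kappa>) \<le> real (k - l) * ?e m" .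
  have "real (k - l) * min (?e l) (?e k) \<le> real (k - m) * ?e l + real (m - l) * ?e k"
    unfolding kl(1) distrib_right by (intro add_mono mult_left_mono) auto
  with main have "real (k - l) * (min (?e l) (?e k) + t * \<kappa>) \<le> real (k - l) * ?e m"
    by (simp add: distrib_left)
  then have e: "min (?e l) (?e k) + t * \<kappa> \<le> ?e m" using kl(2) by simp
  have w: "?w j \<le> exp (- (t * \<kappa> / \<epsilon>))" if "?e j \<le> ?e m - t * \<kappa>" for j
  proof -
    have "?w j \<le> exp (?e j / \<epsilon> - ?e m / \<epsilon>)"
      unfolding weight_def using assms by (intro gibbs_le_exp_diff) auto
    also have "\<dots> \<le> exp (- (t * \<kappa> / \<epsilon>))"
      using that assms(4) by (simp add: divide_simps)
    finally show ?thesis .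
  qed
  show ?thesis
  proof (cases "?e l \<le> ?e k")
    case True
    then have "?w k * ?w l \<le> 1 * exp (- (t * \<kappa> / \<epsilon>))"
      using e w[of l] assms by (intro mult_mono weight_le_1 weight_nonneg) auto
    then show ?thesis by simp
  next
    case False
    then have "?w k * ?w l \<le> exp (- (t * \<kappa> / \<epsilon>)) * 1"
      using e w[of k] assms by (intro mult_mono weight_le_1 weight_nonneg) auto
    then show ?thesis by simp
  qed
qed

text \<open>Admissible pairs contribute at most \<open>L / (2 * n)\<close> times their share of \<open>mean_x\<close>, the others an
exponentially small amount away from time \<open>0\<close>.\<close>

lemma production_le:
  obtains \<kappa> where "\<kappa> > 0"
    "\<And>\<epsilon> s t y u. \<lbrakk>\<epsilon> > 0; 0 \<le> s; s \<le> t; u \<in> {0..1}\<rbrakk> \<Longrightarrow>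
       production \<epsilon> t y u \<le> L / (2 * real n) * mean_x \<epsilon> t y
         + 2 * speed_bound * (real n + 1)\<^sup>2 * (exp (- (s * \<kappa> / \<epsilon>)) / \<epsilon>)"
proof -
  obtain \<kappa> where \<kappa>: "\<kappa> > 0"
    "\<And>l k. \<lbrakk>l < k; k \<le> n; \<not> chord_below n l k\<rbrakk> \<Longrightarrow> \<exists>m. l < m \<and> m < k \<and>
      real (k - l) * (\<Lambda> (real m / real n) + \<kappa>)
      \<le> real (k - m) * \<Lambda> (real l / real n) + real (m - l) * \<Lambda> (real k / real n)"
    using chord_gap by blast
  have "production \<epsilon> t y u \<le> L / (2 * real n) * mean_x \<epsilon> t y
         + 2 * speed_bound * (real n + 1)\<^sup>2 * (exp (- (s * \<kappa> / \<epsilon>)) / \<epsilon>)"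
    if h: "\<epsilon> > 0" "0 \<le> s" "s \<le> t" "u \<in> {0..1}" for \<epsilon> s t y u
  proof -
    let ?w = "weight \<epsilon> t y" and ?E = "exp (- (s * \<kappa> / \<epsilon>)) * (4 * speed_bound)"
    let ?P = "\<lambda>k l. ?w k * ?w l * pair_production u (node k) (node l)"
    let ?D = "\<lambda>k l. L / (2 * real n) * (?w k * ?w l * (node k - node l)\<^sup>2)"
    have E: "0 \<le> ?E" using speed_bound_nonneg by simp
    have D: "0 \<le> ?D k l" for k l using weight_nonneg L_nonneg by simp
    \<comment> \<open>It is enough to treat ordered pairs, because both sides are symmetric.\<close>
    have less: "?P k l \<le> ?D k l + ?E" if lk: "l < k" "k \<le> n" for k l
    proof (cases "chord_below n l k")
      case True
      have "?P k l \<le> ?w k * ?w l * (L / (2 * real n) * (node k - node l)\<^sup>2)"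
        using pair_production_chord_below[OF n_pos lk True h(4)] weight_nonneg
        by (intro mult_left_mono mult_nonneg_nonneg) auto
      then show ?thesis using E by (simp add: mult_ac)
    next
      case False
      then obtain m where m: "l < m" "m < k" "real (k - l) * (\<Lambda> (node m) + \<kappa>)
          \<le> real (k - m) * \<Lambda> (node l) + real (m - l) * \<Lambda> (node k)"
        using \<kappa>(2) lk by blast
      have "?w k * ?w l \<le> exp (- (t * \<kappa> / \<epsilon>))"
        using min_weight_le[OF m(1,2) lk(2) h(1) _ m(3)] h by auto
      also have "\<dots> \<le> exp (- (s * \<kappa> / \<epsilon>))"
        using h \<kappa>(1) by (simp add: divide_right_mono)
      finally have ww: "?w k * ?w l \<le> exp (- (s * \<kappa> / \<epsilon>))" .
      have "pair_production u (node k) (node l) \<le> 4 * speed_bound * (node k - node l)\<^sup>2"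
        using lk h by (intro pair_production_le node_in) auto
      also have "\<dots> \<le> 4 * speed_bound * 1"
      proof (intro mult_left_mono power_le_one)
        have "node k \<le> 1" using node_in[OF lk(2)] by (simp only: atLeastAtMost_iff)
        moreover have "0 \<le> node l" by simp
        ultimately show "node k - node l \<le> 1" by linarith
      qed (use speed_bound_nonneg lk in \<open>auto simp: divide_right_mono\<close>)
      finally have "?P k l \<le> ?w k * ?w l * (4 * speed_bound)"
        using weight_nonneg by (intro mult_left_mono mult_nonneg_nonneg) auto
      also have "\<dots> \<le> exp (- (s * \<kappa> / \<epsilon>)) * (4 * speed_bound)"
        using ww speed_bound_nonneg by (intro mult_right_mono) auto
      finally show ?thesis using D[of k l] by linarith
    qed
    have "?P k l \<le> ?D k l + ?E" if "k \<le> n" "l \<le> n" for k l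
    proof -
      consider "l < k" | "k < l" | "k = l" by linarith
      then show ?thesis
      proof cases
        case 2
        then show ?thesis using less[of k l] that
          by (simp add: mult.commute[of "?w k"] pair_production_commute[of u "node k"] power2_commute[of "node k"])
      next
        case 3
        then show ?thesis using E by (simp add: pair_production_def)
      qed (use less that in auto)
    qed
    then have "(\<Sum>k\<le>n. \<Sum>l\<le>n. ?P k l) \<le> (\<Sum>k\<le>n. \<Sum>l\<le>n. ?D k l + ?E)"
      by (intro sum_mono) auto
    also have "\<dots> = L / (2 * real n) * (\<Sum>k\<le>n. \<Sum>l\<le>n. ?w k * ?w l * (node k - node l)\<^sup>2)
        + (real n + 1)\<^sup>2 * ?E"
    proof -
      have "(\<Sum>k\<le>n. \<Sum>l\<le>n. ?E) = (real n + 1)\<^sup>2 * ?E"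
        by (simp add: power2_eq_square algebra_simps)
      then show ?thesis by (simp only: sum.distrib sum_distrib_left)
    qed
    finally show ?thesis
      unfolding production_eq mean_x_eq using h(1) by (simp add: field_simps)
  qed
  with \<kappa>(1) show ?thesis by (rule that)
qed

end

section \<open>Kruzkov's inequality tested with Gibbs weights\<close>

lemma deriv_zero_on_open:
  fixes \<phi> :: "real \<Rightarrow> real \<Rightarrow> real"
  assumes C: "open C" "(t, x) \<in> C" and zero: "\<And>t x. (t, x) \<in> C \<Longrightarrow> \<phi> t x = 0"
  shows "deriv (\<lambda>s. \<phi> s x) t = 0" "deriv (\<lambda>y. \<phi> t y) x = 0"
proof -
  have o: "open ((\<lambda>s. (s, x)) -` C)" "open ((\<lambda>y. (t, y)) -` C)"
    by (intro open_vimage C(1) continuous_intros)+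
  have ev: "eventually (\<lambda>s. (s, x) \<in> C) (nhds t)" "eventually (\<lambda>y. (t, y) \<in> C) (nhds x)"
    using eventually_nhds_in_open[OF o(1), of t] eventually_nhds_in_open[OF o(2), of x] C(2)
    by simp_all
  have "deriv (\<lambda>s. \<phi> s x) t = deriv (\<lambda>s. 0) t"
    by (rule deriv_cong_ev[OF eventually_mono[OF ev(1)]]) (simp_all add: zero)
  then show "deriv (\<lambda>s. \<phi> s x) t = 0" by simp
  have "deriv (\<lambda>y. \<phi> t y) x = deriv (\<lambda>y. 0) x"
    by (rule deriv_cong_ev[OF eventually_mono[OF ev(2)]]) (simp_all add: zero)
  then show "deriv (\<lambda>y. \<phi> t y) x = 0" by simp
qed

text \<open>The solution \<open>u\<close>, together with a smooth step \<open>g\<close> and its derivative \<open>g'\<close>.\<close>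

locale kruzkov_setting = sticky_setting +
  fixes u :: "real \<Rightarrow> real \<Rightarrow> real" and g g' :: "real \<Rightarrow> real"
  assumes entropy: "entropy_solution \<Lambda> (cdf (empirical_measure n x)) u"
    and g_smooth: "smooth_line g" and g_deriv: "\<And>y. (g has_real_derivative g' y) (at y)"
    and g'_nonneg: "\<And>y. 0 \<le> g' y" and g_zero: "\<And>y. y \<le> 0 \<Longrightarrow> g y = 0"
    and g_one: "\<And>y. y \<ge> 1 \<Longrightarrow> g y = 1" and g'_zero: "\<And>y. y \<notin> {0<..<1} \<Longrightarrow> g' y = 0"
    and g'_cont: "continuous_on UNIV g'"
begin

abbreviation u0 :: "real \<Rightarrow> real" where "u0 \<equiv> cdf (empirical_measure n x)"

definition half_plane :: "(real \<times> real) set" where "half_plane = {0..} \<times> UNIV"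

text \<open>The solution extended by \<open>0\<close> to negative times, so that it is a Borel function on the whole plane.\<close>

definition U :: "real \<times> real \<Rightarrow> real" where
  "U p = indicator half_plane p *\<^sub>R (case p of (t, y) \<Rightarrow> u t y)"

lemma half_plane_measurable [measurable]: "half_plane \<in> sets borel"
  unfolding half_plane_def by (intro borel_closed closed_Times) auto

lemma U_eq: "t \<ge> 0 \<Longrightarrow> U (t, y) = u t y"
  by (simp add: U_def half_plane_def)

lemma U_range: "U p \<in> {0..1}"
  using entropy unfolding entropy_solution_def U_def half_plane_def
  by (cases p) (auto simp: indicator_def)

lemma U_measurable [measurable]: "U \<in> borel_measurable borel"
proof -
  have "(\<lambda>(t, y). u t y) \<in> borel_measurable (restrict_space borel half_plane)"
    using entropy unfolding entropy_solution_def half_plane_def by blast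
  then show ?thesis
    unfolding U_def[abs_def] by (subst (asm) borel_measurable_restrict_space_iff) auto
qed

lemma U_section_measurable [measurable]: "(\<lambda>y. U (t, y)) \<in> borel_measurable borel"
proof -
  have "(\<lambda>y. (t, y)) \<in> measurable borel (borel :: (real \<times> real) measure)"
    by (intro borel_measurable_continuous_onI continuous_intros)
  from measurable_compose[OF this U_measurable] show ?thesis .
qed

lemma u0_eq: "u0 y = real (card {k \<in> {1..n}. x k \<le> y}) / real n"
  using cdf_empirical_measure[OF n_pos] .

lemma u0_range: "u0 y \<in> {0..1}"
proof -
  have "card {k \<in> {1..n}. x k \<le> y} \<le> card {1..n}" by (intro card_mono) auto
  then show ?thesis unfolding u0_eq using n_pos by (auto simp: divide_le_eq_1)
qed

lemma u0_measurable [measurable]: "u0 \<in> borel_measurable borel"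
proof (intro borel_measurable_mono monoI)
  fix y z :: real assume "y \<le> z"
  then have "card {k \<in> {1..n}. x k \<le> y} \<le> card {k \<in> {1..n}. x k \<le> z}"
    by (intro card_mono) auto
  then show "u0 y \<le> u0 z" unfolding u0_eq by (simp add: divide_right_mono)
qed

text \<open>Outside \<open>[0, 1]\<close> nothing is known about \<open>\<Lambda>\<close>; since \<open>U\<close> stays inside, clamping the argument makes it
continuous without changing the composition.\<close>

lemma kruzkov_flux_U_measurable [measurable]: "(\<lambda>p. kruzkov_flux (U p) c) \<in> borel_measurable borel"
proof -
  have "continuous_on {0..1} \<Lambda>"
    by (rule DERIV_continuous_on) (rule flux_deriv)
  then have "continuous_on UNIV (\<lambda>w. \<Lambda> (max 0 (min 1 w)))"
    by (rule continuous_on_compose2) (auto intro!: continuous_intros)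
  then have [measurable]: "(\<lambda>w. \<Lambda> (max 0 (min 1 w))) \<in> borel_measurable borel"
    by (rule borel_measurable_continuous_onI)
  have "kruzkov_flux (U p) c = sgn (U p - c) * (\<Lambda> (max 0 (min 1 (U p))) - \<Lambda> c)" for p
    using U_range[of p] by (simp add: kruzkov_flux_def)
  then show ?thesis by simp
qed

definition kruzkov_integrand :: "real \<Rightarrow> (real \<Rightarrow> real \<Rightarrow> real) \<Rightarrow> real \<times> real \<Rightarrow> real" where
  "kruzkov_integrand c \<phi> p = \<bar>U p - c\<bar> * deriv (\<lambda>s. \<phi> s (snd p)) (fst p)
     + kruzkov_flux (U p) c * deriv (\<lambda>y. \<phi> (fst p) y) (snd p)"

lemma kruzkov_integrand_integrable:
  assumes "test_function \<phi>" "c \<in> {0..1}"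
  shows "integrable lborel (\<lambda>p. indicator half_plane p * kruzkov_integrand c \<phi> p)"
proof -
  define K where "K = closure {(t, x). \<phi> t x \<noteq> 0}"
  let ?dt = "\<lambda>p. deriv (\<lambda>s. \<phi> s (snd p)) (fst p)" and ?dx = "\<lambda>p. deriv (\<lambda>y. \<phi> (fst p) y) (snd p)"
  have K: "compact K" and smooth: "smooth_plane \<phi>"
    using assms(1) unfolding test_function_def K_def by blast+
  have zero: "\<phi> t x = 0" if "(t, x) \<in> - K" for t x
    using that closure_subset[of "{(t, x). \<phi> t x \<noteq> 0}"] unfolding K_def by blast
  have outside: "kruzkov_integrand c \<phi> p = 0" if "p \<notin> K" for p
    using deriv_zero_on_open[of "- K" "fst p" "snd p" \<phi>, OF _ _ zero] that compact_imp_closed[OF K]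
    by (simp add: kruzkov_integrand_def open_Compl)
  have cont: "continuous_on UNIV ?dt" "continuous_on UNIV ?dx"
    using smooth_plane_deriv_t[OF smooth] smooth_plane_deriv_x[OF smooth] by (simp_all add: case_prod_beta)
  have "(\<lambda>p. \<bar>U p - c\<bar>) \<in> borel_measurable borel" by measurable
  then have "kruzkov_integrand c \<phi> \<in> borel_measurable borel"
    unfolding kruzkov_integrand_def[abs_def]
    by (intro borel_measurable_add borel_measurable_times borel_measurable_continuous_onI[OF cont(1)]
        borel_measurable_continuous_onI[OF cont(2)] kruzkov_flux_U_measurable)
  then have meas: "(\<lambda>p. indicator half_plane p * kruzkov_integrand c \<phi> p) \<in> borel_measurable lborel"
    by (intro borel_measurable_times) (simp_all add: borel_measurable_indicator)
  have "integrable lborel (\<lambda>p. indicator K p *\<^sub>R (\<bar>?dt p\<bar> + speed_bound * \<bar>?dx p\<bar>))"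
    by (intro borel_integrable_compact K continuous_intros
        continuous_on_subset[OF cont(1)] continuous_on_subset[OF cont(2)]) simp_all
  then show ?thesis
  proof (rule Bochner_Integration.integrable_bound)
    show "AE p in lborel. norm (indicator half_plane p * kruzkov_integrand c \<phi> p)
        \<le> norm (indicator K p *\<^sub>R (\<bar>?dt p\<bar> + speed_bound * \<bar>?dx p\<bar>))"
    proof (rule AE_I2)
      fix p
      have Uc: "\<bar>U p - c\<bar> \<le> 1" using U_range[of p] assms(2) by auto
      have "\<bar>kruzkov_integrand c \<phi> p\<bar> \<le> \<bar>\<bar>U p - c\<bar> * ?dt p\<bar> + \<bar>kruzkov_flux (U p) c * ?dx p\<bar>"
        unfolding kruzkov_integrand_def by (rule abs_triangle_ineq)
      also have "\<dots> = \<bar>U p - c\<bar> * \<bar>?dt p\<bar> + \<bar>kruzkov_flux (U p) c\<bar> * \<bar>?dx p\<bar>"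
        by (simp add: abs_mult)
      also have "\<dots> \<le> 1 * \<bar>?dt p\<bar> + speed_bound * \<bar>?dx p\<bar>"
      proof (intro add_mono mult_right_mono Uc)
        have "\<bar>kruzkov_flux (U p) c\<bar> \<le> speed_bound * \<bar>U p - c\<bar>"
          using U_range assms(2) by (rule kruzkov_flux_le)
        also have "\<dots> \<le> speed_bound * 1" using Uc speed_bound_nonneg by (intro mult_left_mono) auto
        finally show "\<bar>kruzkov_flux (U p) c\<bar> \<le> speed_bound" by simp
      qed auto
      finally have "\<bar>kruzkov_integrand c \<phi> p\<bar> \<le> \<bar>?dt p\<bar> + speed_bound * \<bar>?dx p\<bar>" by simp
      then have "\<bar>kruzkov_integrand c \<phi> p\<bar>
          \<le> indicator K p * (\<bar>?dt p\<bar> + speed_bound * \<bar>?dx p\<bar>)"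
        using outside[of p] by (cases "p \<in> K") simp_all
      moreover have "norm (indicator half_plane p * kruzkov_integrand c \<phi> p) \<le> \<bar>kruzkov_integrand c \<phi> p\<bar>"
        by (simp add: indicator_def)
      ultimately show "norm (indicator half_plane p * kruzkov_integrand c \<phi> p)
        \<le> norm (indicator K p *\<^sub>R (\<bar>?dt p\<bar> + speed_bound * \<bar>?dx p\<bar>))"
        unfolding real_norm_def real_scaleR_def by linarith
    qed
  qed (rule meas)
qed

lemma kruzkov_inequality:
  assumes "test_function \<phi>" "c \<in> {0..1}" "\<And>t x. t \<ge> 0 \<Longrightarrow> 0 \<le> \<phi> t x"
  shows "0 \<le> (LINT p|lborel. indicator half_plane p * kruzkov_integrand c \<phi> p)
      + (LINT y|lborel. \<bar>u0 y - c\<bar> * \<phi> 0 y)"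
proof -
  have "0 \<le> set_lebesgue_integral lborel ({0..} \<times> UNIV)
            (\<lambda>(t, x). \<bar>u t x - c\<bar> * deriv (\<lambda>s. \<phi> s x) t
               + sgn (u t x - c) * (\<Lambda> (u t x) - \<Lambda> c) * deriv (\<lambda>y. \<phi> t y) x)
          + (LINT x|lborel. \<bar>u0 x - c\<bar> * \<phi> 0 x)"
  proof -
    have "kruzkov_condition \<Lambda> u0 u" using entropy by (simp add: entropy_solution_def)
    from this[unfolded kruzkov_condition_def, THEN bspec, OF assms(2), THEN spec, of \<phi>]
    show ?thesis using assms(1,3) by simp
  qed
  also have "set_lebesgue_integral lborel ({0..} \<times> UNIV)
            (\<lambda>(t, x). \<bar>u t x - c\<bar> * deriv (\<lambda>s. \<phi> s x) t
               + sgn (u t x - c) * (\<Lambda> (u t x) - \<Lambda> c) * deriv (\<lambda>y. \<phi> t y) x)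
      = (LINT p|lborel. indicator half_plane p * kruzkov_integrand c \<phi> p)"
    unfolding set_lebesgue_integral_def
    by (intro Bochner_Integration.integral_cong refl)
       (auto simp: half_plane_def indicator_def kruzkov_integrand_def kruzkov_flux_def U_eq)
  finally show ?thesis .
qed

text \<open>A cutoff in space whose support shrinks at the maximal speed of propagation.  It is \<open>1\<close> for
\<open>\<bar>y\<bar> \<le> R - 1 - speed_bound * t\<close> and \<open>0\<close> for \<open>\<bar>y\<bar> \<ge> R - speed_bound * t\<close>.\<close>

definition cone :: "real \<Rightarrow> real \<Rightarrow> real \<Rightarrow> real" where
  "cone R t y = g (R - speed_bound * t - y) * g (R - speed_bound * t + y)"

definition cone_x :: "real \<Rightarrow> real \<Rightarrow> real \<Rightarrow> real" where
  "cone_x R t y = - g' (R - speed_bound * t - y) * g (R - speed_bound * t + y)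
      + g (R - speed_bound * t - y) * g' (R - speed_bound * t + y)"

definition cone_t :: "real \<Rightarrow> real \<Rightarrow> real \<Rightarrow> real" where
  "cone_t R t y = - speed_bound * (g' (R - speed_bound * t - y) * g (R - speed_bound * t + y)
      + g (R - speed_bound * t - y) * g' (R - speed_bound * t + y))"

text \<open>A cutoff in time that falls from \<open>1\<close> to \<open>0\<close> on \<open>[T, T + \<delta>]\<close>; minus its derivative is the kernel, an
average over this window.\<close>

definition time_cutoff :: "real \<Rightarrow> real \<Rightarrow> real \<Rightarrow> real" where
  "time_cutoff T \<delta> t = g ((T + \<delta> - t) / \<delta>)"

definition time_kernel :: "real \<Rightarrow> real \<Rightarrow> real \<Rightarrow> real" where
  "time_kernel T \<delta> t = g' ((T + \<delta> - t) / \<delta>) / \<delta>"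

text \<open>The test function paired with the constant \<open>node k\<close>.  The factor \<open>g (t + 1)\<close> makes the support
compact and equals \<open>1\<close> for \<open>t \<ge> 0\<close>.\<close>

definition probe :: "real \<Rightarrow> real \<Rightarrow> real \<Rightarrow> real \<Rightarrow> nat \<Rightarrow> real \<Rightarrow> real \<Rightarrow> real" where
  "probe \<epsilon> R T \<delta> k t y = weight \<epsilon> t y k * (g (t + 1) * time_cutoff T \<delta> t * cone R t y)"

lemma g_mono: "y \<le> z \<Longrightarrow> g y \<le> g z"
  by (rule DERIV_nonneg_imp_nondecreasing[of y z g]) (use g_deriv g'_nonneg in auto)

lemma g_range: "0 \<le> g y" "g y \<le> 1"
  using g_mono[of "min y 0" y] g_mono[of y "max y 1"] g_zero[of "min y 0"] g_one[of "max y 1"] by auto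

lemma g_cont: "continuous_on UNIV g"
  using g_deriv by (meson DERIV_continuous_on has_field_derivative_at_within)

lemma cone_range: "0 \<le> cone R t y" "cone R t y \<le> 1"
  unfolding cone_def using g_range by (auto intro: mult_le_one)

lemma time_cutoff_range: "0 \<le> time_cutoff T \<delta> t" "time_cutoff T \<delta> t \<le> 1"
  unfolding time_cutoff_def using g_range by auto

lemma cone_outside: "\<bar>y\<bar> > R - speed_bound * t \<Longrightarrow> cone R t y = 0"
  unfolding cone_def using g_zero[of "R - speed_bound * t - y"] g_zero[of "R - speed_bound * t + y"]
  by (cases "y \<ge> 0") auto

lemma cone_outside': "t \<ge> 0 \<Longrightarrow> \<bar>y\<bar> > R \<Longrightarrow> cone R t y = 0"
  using cone_outside[of R t y] mult_nonneg_nonneg[OF speed_bound_nonneg, of t] by auto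

text \<open>Information travels at most at speed \<open>speed_bound\<close>, so the entropy leaving the shrinking cone
dominates the entropy flux through its boundary.\<close>

lemma cone_transport:
  assumes "w \<in> {0..1}" "c \<in> {0..1}"
  shows "\<bar>w - c\<bar> * cone_t R t y + kruzkov_flux w c * cone_x R t y \<le> 0"
proof -
  let ?a = "g' (R - speed_bound * t - y) * g (R - speed_bound * t + y)"
  let ?b = "g (R - speed_bound * t - y) * g' (R - speed_bound * t + y)"
  have ab: "0 \<le> ?a" "0 \<le> ?b" using g_range g'_nonneg by auto
  have "kruzkov_flux w c * cone_x R t y \<le> \<bar>kruzkov_flux w c\<bar> * \<bar>cone_x R t y\<bar>"
    by (metis abs_ge_self abs_mult)
  also have "\<dots> \<le> (speed_bound * \<bar>w - c\<bar>) * (?a + ?b)"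
    using ab by (intro mult_mono kruzkov_flux_le assms) (auto simp: cone_x_def speed_bound_nonneg)
  finally show ?thesis by (simp add: cone_t_def algebra_simps)
qed

lemma smooth_plane_probe: "smooth_plane (probe \<epsilon> R T \<delta> k)"
proof -
  have s: "smooth_plane (\<lambda>t y. g (t + 1))"
    using smooth_plane_compose_affine[OF g_smooth, of 1 0 1] by simp
  have s': "smooth_plane (\<lambda>t y. g ((T + \<delta> - t) / \<delta>))"
    using smooth_plane_compose_affine[OF g_smooth, of "- 1 / \<delta>" 0 "(T + \<delta>) / \<delta>"]
    by (simp add: diff_divide_distrib)
  have s'': "smooth_plane (\<lambda>t y. g (R - speed_bound * t - y))"
    "smooth_plane (\<lambda>t y. g (R - speed_bound * t + y))"
    using smooth_plane_compose_affine[OF g_smooth, of "- speed_bound" "- 1" R]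
      smooth_plane_compose_affine[OF g_smooth, of "- speed_bound" 1 R]
    by (simp_all add: algebra_simps)
  show ?thesis
    unfolding probe_def[abs_def] time_cutoff_def cone_def
    by (intro smooth_plane_mult smooth_plane_weight s s' s'')
qed

lemma test_function_probe:
  assumes "\<delta> > 0"
  shows "test_function (probe \<epsilon> R T \<delta> k)"
proof -
  let ?B = "{-1..T + \<delta>} \<times> {- (R + speed_bound)..R + speed_bound}"
  have "{(t, y). probe \<epsilon> R T \<delta> k t y \<noteq> 0} \<subseteq> ?B"
  proof (intro subsetI, clarsimp)
    fix t y assume nz: "probe \<epsilon> R T \<delta> k t y \<noteq> 0"
    have t: "-1 \<le> t" using nz g_zero[of "t + 1"] by (force simp: probe_def)
    have T: "t \<le> T + \<delta>"
    proof (rule ccontr)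
      assume "\<not> t \<le> T + \<delta>"
      then have "(T + \<delta> - t) / \<delta> \<le> 0" using assms by (simp add: divide_le_0_iff)
      then show False using nz g_zero by (simp add: probe_def time_cutoff_def)
    qed
    have "\<bar>y\<bar> \<le> R - speed_bound * t"
      using nz cone_outside[of R t y] by (force simp: probe_def)
    moreover have "speed_bound * (- 1) \<le> speed_bound * t" using t speed_bound_nonneg by (intro mult_left_mono) auto
    ultimately show "-1 \<le> t \<and> t \<le> T + \<delta> \<and> - R - speed_bound \<le> y \<and> y \<le> R + speed_bound"
      using t T by auto
  qed
  moreover have "bounded ?B" by (intro bounded_Times bounded_closed_interval)
  ultimately have "bounded {(t, y). probe \<epsilon> R T \<delta> k t y \<noteq> 0}" by (rule bounded_subset[rotated])
  then show ?thesis
    unfolding test_function_def using smooth_plane_probe by (simp add: compact_closure)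
qed

lemma probe_nonneg: "0 \<le> probe \<epsilon> R T \<delta> k t y"
  unfolding probe_def using weight_nonneg g_range time_cutoff_range cone_range by auto

lemma probe_derivatives:
  assumes "\<delta> > 0" "k \<le> n" "t \<ge> 0"
  shows "deriv (\<lambda>s. probe \<epsilon> R T \<delta> k s y) t = weight_t \<epsilon> t y k * (time_cutoff T \<delta> t * cone R t y)
      + weight \<epsilon> t y k * (- time_kernel T \<delta> t * cone R t y + time_cutoff T \<delta> t * cone_t R t y)"
    and "deriv (\<lambda>z. probe \<epsilon> R T \<delta> k t z) y = weight_x \<epsilon> t y k * (time_cutoff T \<delta> t * cone R t y)
      + weight \<epsilon> t y k * (time_cutoff T \<delta> t * cone_x R t y)"
proof -
  have g1: "g (t + 1) = 1" "g' (t + 1) = 0" using assms g_one[of "t + 1"] g'_zero[of "t + 1"] by auto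
  have a: "((\<lambda>s. g (s + 1)) has_real_derivative 0) (at t)"
  proof (rule DERIV_cong[OF DERIV_chain'[OF _ g_deriv]])
    show "((\<lambda>s. s + 1) has_real_derivative 1) (at t)" by (auto intro!: derivative_eq_intros)
  qed (simp add: g1)
  have b: "(time_cutoff T \<delta> has_real_derivative - time_kernel T \<delta> t) (at t)"
    unfolding time_cutoff_def[abs_def] time_kernel_def
  proof (rule DERIV_cong[OF DERIV_chain'[OF _ g_deriv]])
    show "((\<lambda>s. (T + \<delta> - s) / \<delta>) has_real_derivative (0 - 1) / \<delta>) (at t)"
      by (intro DERIV_cdivide DERIV_diff DERIV_const DERIV_ident)
  qed simp
  have i: "((\<lambda>s. R - speed_bound * s - y) has_real_derivative - speed_bound) (at t)"
    "((\<lambda>s. R - speed_bound * s + y) has_real_derivative - speed_bound) (at t)"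
    "((\<lambda>z. R - speed_bound * t - z) has_real_derivative - 1) (at y)"
    "((\<lambda>z. R - speed_bound * t + z) has_real_derivative 1) (at y)"
    by (auto intro!: derivative_eq_intros)
  have c: "((\<lambda>s. cone R s y) has_real_derivative cone_t R t y) (at t)"
    unfolding cone_def cone_t_def
    by (rule DERIV_cong[OF DERIV_mult[OF DERIV_chain'[OF i(1) g_deriv] DERIV_chain'[OF i(2) g_deriv]]])
       (simp add: algebra_simps)
  have d: "((\<lambda>z. cone R t z) has_real_derivative cone_x R t y) (at y)"
    unfolding cone_def cone_x_def
    by (rule DERIV_cong[OF DERIV_mult[OF DERIV_chain'[OF i(3) g_deriv] DERIV_chain'[OF i(4) g_deriv]]])
       (simp add: algebra_simps)
  show "deriv (\<lambda>s. probe \<epsilon> R T \<delta> k s y) t = weight_t \<epsilon> t y k * (time_cutoff T \<delta> t * cone R t y)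
      + weight \<epsilon> t y k * (- time_kernel T \<delta> t * cone R t y + time_cutoff T \<delta> t * cone_t R t y)"
    unfolding probe_def
    by (rule DERIV_imp_deriv, rule DERIV_cong[OF DERIV_mult[OF weight_has_derivative_t[OF assms(2)]
          DERIV_mult[OF DERIV_mult[OF a b] c]]]) (unfold g1, simp add: algebra_simps)
  show "deriv (\<lambda>z. probe \<epsilon> R T \<delta> k t z) y = weight_x \<epsilon> t y k * (time_cutoff T \<delta> t * cone R t y)
      + weight \<epsilon> t y k * (time_cutoff T \<delta> t * cone_x R t y)"
    unfolding probe_def
    by (rule DERIV_imp_deriv, rule DERIV_cong[OF DERIV_mult[OF weight_has_derivative_x[OF assms(2)]
          DERIV_cmult[OF d]]]) (unfold g1, simp add: algebra_simps)
qed

text \<open>In the limit of zero temperature this is the distance of \<open>w\<close> to the sticky particle value.\<close>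

definition spread :: "real \<Rightarrow> real \<Rightarrow> real \<Rightarrow> real \<Rightarrow> real" where
  "spread \<epsilon> t y w = (\<Sum>k\<le>n. weight \<epsilon> t y k * \<bar>w - node k\<bar>)"

lemma sum_kruzkov_integrand_le:
  assumes "\<delta> > 0" "t \<ge> 0"
  shows "(\<Sum>k\<le>n. kruzkov_integrand (node k) (probe \<epsilon> R T \<delta> k) (t, y))
    \<le> - (time_kernel T \<delta> t * (spread \<epsilon> t y (U (t, y)) * cone R t y))
      + time_cutoff T \<delta> t * cone R t y * production \<epsilon> t y (U (t, y))"
proof -
  let ?w = "U (t, y)" and ?X = "time_cutoff T \<delta> t"
  have "kruzkov_integrand (node k) (probe \<epsilon> R T \<delta> k) (t, y)
     \<le> ?X * cone R t y * (\<bar>?w - node k\<bar> * weight_t \<epsilon> t y k + kruzkov_flux ?w (node k) * weight_x \<epsilon> t y k)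
       - time_kernel T \<delta> t * cone R t y * (weight \<epsilon> t y k * \<bar>?w - node k\<bar>)" if k: "k \<le> n" for k
  proof -
    have "?X * weight \<epsilon> t y k * (\<bar>?w - node k\<bar> * cone_t R t y + kruzkov_flux ?w (node k) * cone_x R t y) \<le> 0"
      using cone_transport[OF U_range node_in[OF k]] time_cutoff_range weight_nonneg
      by (intro mult_nonneg_nonpos mult_nonneg_nonneg) auto
    then show ?thesis
      unfolding kruzkov_integrand_def fst_conv snd_conv probe_derivatives[OF assms(1) k assms(2)]
      by (simp add: algebra_simps)
  qed
  then have "(\<Sum>k\<le>n. kruzkov_integrand (node k) (probe \<epsilon> R T \<delta> k) (t, y))
     \<le> (\<Sum>k\<le>n. ?X * cone R t y * (\<bar>?w - node k\<bar> * weight_t \<epsilon> t y k + kruzkov_flux ?w (node k) * weight_x \<epsilon> t y k)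
       - time_kernel T \<delta> t * cone R t y * (weight \<epsilon> t y k * \<bar>?w - node k\<bar>))"
    by (intro sum_mono) auto
  also have "\<dots> = ?X * cone R t y * production \<epsilon> t y ?w - time_kernel T \<delta> t * cone R t y * spread \<epsilon> t y ?w"
    by (simp only: sum_subtractf sum_distrib_left production_def spread_def)
  finally show ?thesis by (simp add: mult_ac)
qed

end

section \<open>Integration over space and time\<close>

context kruzkov_setting
begin

lemma weight_continuous: "continuous_on S (\<lambda>p. weight \<epsilon> (fst p) (snd p) k)"
  using smooth_plane_continuous[OF smooth_plane_weight, of \<epsilon> k]
  by (auto simp: case_prod_beta intro: continuous_on_subset)

lemma weight_continuous_y: "continuous_on S (\<lambda>y. weight \<epsilon> t y k)"
  by (rule continuous_on_compose2[OF weight_continuous[of UNIV \<epsilon> k], of S "\<lambda>y. (t, y)", simplified])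
     (auto intro!: continuous_intros)

lemma mean_x_continuous: "continuous_on S (\<lambda>p. mean_x \<epsilon> (fst p) (snd p))"
  unfolding mean_x_eq divide_inverse by (intro continuous_intros weight_continuous)

lemma mean_x_continuous_y: "continuous_on S (\<lambda>y. mean_x \<epsilon> t y)"
  unfolding mean_x_eq divide_inverse by (intro continuous_intros weight_continuous_y)

lemma cone_continuous: "continuous_on S (\<lambda>p. cone R (fst p) (snd p))"
  unfolding cone_def
  by (intro continuous_intros continuous_on_compose2[OF g_cont]) auto

lemma cone_continuous_y: "continuous_on S (\<lambda>y. cone R t y)"
  unfolding cone_def
  by (intro continuous_intros continuous_on_compose2[OF g_cont]) auto

lemma time_kernel_continuous: "continuous_on UNIV (time_kernel T \<delta>)"
  unfolding time_kernel_def[abs_def] divide_inverse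
  by (intro continuous_intros continuous_on_compose2[OF g'_cont]) auto

lemma time_kernel_nonneg: "\<delta> > 0 \<Longrightarrow> 0 \<le> time_kernel T \<delta> t"
  unfolding time_kernel_def using g'_nonneg by simp

lemma time_kernel_outside:
  assumes "\<delta> > 0" "t \<notin> {T..T + \<delta>}"
  shows "time_kernel T \<delta> t = 0"
proof -
  have "(T + \<delta> - t) / \<delta> \<notin> {0<..<1}" using assms by (auto simp: field_simps)
  then show ?thesis unfolding time_kernel_def by (simp add: g'_zero)
qed

lemma time_kernel_integral:
  assumes "\<delta> > 0"
  shows "has_bochner_integral lborel (time_kernel T \<delta>) 1"
proof -
  have d: "((\<lambda>s. - time_cutoff T \<delta> s) has_real_derivative time_kernel T \<delta> t) (at t)" for t
    unfolding time_cutoff_def time_kernel_def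
  proof (rule DERIV_cong[OF DERIV_minus[OF DERIV_chain'[OF _ g_deriv]]])
    show "((\<lambda>s. (T + \<delta> - s) / \<delta>) has_real_derivative (0 - 1) / \<delta>) (at t)"
      by (intro DERIV_cdivide DERIV_diff DERIV_const DERIV_ident)
  qed simp
  have "has_bochner_integral lborel (\<lambda>t. time_kernel T \<delta> t * indicator {T..T + \<delta>} t)
      (- time_cutoff T \<delta> (T + \<delta>) - - time_cutoff T \<delta> T)"
    using assms
    by (intro has_bochner_integral_FTC_Icc_nonneg borel_measurable_continuous_onI[OF time_kernel_continuous]
        d time_kernel_nonneg) auto
  moreover have "time_kernel T \<delta> t * indicator {T..T + \<delta>} t = time_kernel T \<delta> t" for t
    using time_kernel_outside[OF assms, of t T] by (cases "t \<in> {T..T + \<delta>}") simp_all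
  moreover have "time_cutoff T \<delta> (T + \<delta>) = 0" "time_cutoff T \<delta> T = 1"
    using assms by (simp_all add: time_cutoff_def g_zero g_one)
  ultimately show ?thesis by simp
qed

lemma spread_nonneg: "0 \<le> spread \<epsilon> t y w"
  unfolding spread_def by (intro sum_nonneg mult_nonneg_nonneg weight_nonneg) auto

lemma spread_le_1:
  assumes "w \<in> {0..1}"
  shows "spread \<epsilon> t y w \<le> 1"
proof -
  have "\<bar>w - node k\<bar> \<le> 1" if "k \<le> n" for k
    using node_in[OF that] assms by (simp only: atLeastAtMost_iff) linarith
  then have "spread \<epsilon> t y w \<le> (\<Sum>k\<le>n. weight \<epsilon> t y k * 1)"
    unfolding spread_def by (intro sum_mono mult_left_mono weight_nonneg) auto
  then show ?thesis by (simp add: sum_weight)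
qed

lemma spread_cone_integrable:
  assumes "t \<ge> 0" and [measurable]: "v \<in> borel_measurable borel" and "\<And>y. v y \<in> {0..1}"
  shows "integrable lborel (\<lambda>y. spread \<epsilon> t y (v y) * cone R t y)"
proof -
  have [measurable]: "(\<lambda>y. weight \<epsilon> t y k) \<in> borel_measurable borel" for k
    by (rule borel_measurable_continuous_onI[OF weight_continuous_y])
  have [measurable]: "cone R t \<in> borel_measurable borel"
    by (rule borel_measurable_continuous_onI[OF cone_continuous_y])
  have "integrable lborel (\<lambda>y. indicator {-R..R} y *\<^sub>R (1::real))"
    by (rule borel_integrable_compact) auto
  then show ?thesis
  proof (rule Bochner_Integration.integrable_bound)
    show "AE y in lborel. norm (spread \<epsilon> t y (v y) * cone R t y) \<le> norm (indicator {-R..R} y *\<^sub>R (1::real))"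
    proof (rule AE_I2)
      fix y
      show "norm (spread \<epsilon> t y (v y) * cone R t y) \<le> norm (indicator {-R..R} y *\<^sub>R (1::real))"
      proof (cases "y \<in> {-R..R}")
        case True
        then show ?thesis
          using mult_le_one[OF spread_le_1[OF assms(3)] cone_range] spread_nonneg cone_range
          by (simp add: abs_mult)
      next
        case False
        then have "cone R t y = 0" by (intro cone_outside' assms(1)) auto
        then show ?thesis by simp
      qed
    qed
  qed (unfold spread_def, measurable)
qed

text \<open>The distance, localised to the cone, between the solution at time \<open>t\<close> and the Gibbs approximation.\<close>

definition cone_distance :: "real \<Rightarrow> real \<Rightarrow> real \<Rightarrow> real" where
  "cone_distance \<epsilon> R t = (LINT y|lborel. spread \<epsilon> t y (U (t, y)) * cone R t y)"

definition initial_cone_distance :: "real \<Rightarrow> real \<Rightarrow> real" where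
  "initial_cone_distance \<epsilon> R = (LINT y|lborel. spread \<epsilon> 0 y (u0 y) * cone R 0 y)"

lemma sum_kruzkov_inequality:
  assumes "\<delta> > 0" "T \<ge> 0"
  shows "integrable lborel (\<lambda>p. indicator half_plane p *
        (\<Sum>k\<le>n. kruzkov_integrand (node k) (probe \<epsilon> R T \<delta> k) p))"
    and "0 \<le> (LINT p|lborel. indicator half_plane p *
        (\<Sum>k\<le>n. kruzkov_integrand (node k) (probe \<epsilon> R T \<delta> k) p)) + initial_cone_distance \<epsilon> R"
proof -
  let ?J = "\<lambda>k p. indicator half_plane p * kruzkov_integrand (node k) (probe \<epsilon> R T \<delta> k) p"
  have int: "integrable lborel (?J k)" if "k \<le> n" for k
    by (intro kruzkov_integrand_integrable test_function_probe assms node_in that)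
  then show "integrable lborel (\<lambda>p. indicator half_plane p *
        (\<Sum>k\<le>n. kruzkov_integrand (node k) (probe \<epsilon> R T \<delta> k) p))"
    unfolding sum_distrib_left by (intro Bochner_Integration.integrable_sum) auto
  have "(T + \<delta>) / \<delta> \<ge> 1" using assms by simp
  then have "time_cutoff T \<delta> 0 = 1" by (simp add: time_cutoff_def g_one)
  then have p0: "probe \<epsilon> R T \<delta> k 0 y = weight \<epsilon> 0 y k * cone R 0 y" for k y
    by (simp add: probe_def g_one)
  let ?I = "\<lambda>k y. weight \<epsilon> 0 y k * \<bar>u0 y - node k\<bar> * cone R 0 y"
  have intI: "integrable lborel (?I k)" if "k \<le> n" for k
  proof -
    have [measurable]: "(\<lambda>y. weight \<epsilon> 0 y k) \<in> borel_measurable borel"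
      by (rule borel_measurable_continuous_onI[OF weight_continuous_y])
    have [measurable]: "cone R 0 \<in> borel_measurable borel"
      by (rule borel_measurable_continuous_onI[OF cone_continuous_y])
    show ?thesis
    proof (rule Bochner_Integration.integrable_bound[OF spread_cone_integrable[of 0 u0 \<epsilon> R]])
      show "AE y in lborel. norm (?I k y) \<le> norm (spread \<epsilon> 0 y (u0 y) * cone R 0 y)"
      proof (rule AE_I2)
        fix y
        have "weight \<epsilon> 0 y k * \<bar>u0 y - node k\<bar> \<le> spread \<epsilon> 0 y (u0 y)"
          unfolding spread_def using that weight_nonneg by (intro member_le_sum) auto
        then show "norm (?I k y) \<le> norm (spread \<epsilon> 0 y (u0 y) * cone R 0 y)"
          using weight_nonneg[of \<epsilon> 0 y k] cone_range[of R 0 y]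
          by (simp add: abs_mult mult_right_mono)
      qed
    qed (use u0_range in auto)
  qed
  have "0 \<le> (\<Sum>k\<le>n. (LINT p|lborel. ?J k p) + (LINT y|lborel. ?I k y))"
  proof (intro sum_nonneg)
    fix k assume "k \<in> {..n}"
    then have "0 \<le> (LINT p|lborel. ?J k p) + (LINT y|lborel. \<bar>u0 y - node k\<bar> * probe \<epsilon> R T \<delta> k 0 y)"
      by (intro kruzkov_inequality test_function_probe assms node_in probe_nonneg) auto
    then show "0 \<le> (LINT p|lborel. ?J k p) + (LINT y|lborel. ?I k y)"
      unfolding p0 by (simp add: mult_ac)
  qed
  also have "\<dots> = (LINT p|lborel. (\<Sum>k\<le>n. ?J k p)) + (LINT y|lborel. (\<Sum>k\<le>n. ?I k y))"
  proof -
    have "(LINT p|lborel. (\<Sum>k\<le>n. ?J k p)) = (\<Sum>k\<le>n. LINT p|lborel. ?J k p)"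
      by (intro Bochner_Integration.integral_sum int) auto
    moreover have "(LINT y|lborel. (\<Sum>k\<le>n. ?I k y)) = (\<Sum>k\<le>n. LINT y|lborel. ?I k y)"
      by (intro Bochner_Integration.integral_sum intI) auto
    ultimately show ?thesis by (simp only: sum.distrib)
  qed
  also have "(LINT y|lborel. (\<Sum>k\<le>n. ?I k y)) = initial_cone_distance \<epsilon> R"
    unfolding initial_cone_distance_def spread_def sum_distrib_right ..
  finally show "0 \<le> (LINT p|lborel. indicator half_plane p *
        (\<Sum>k\<le>n. kruzkov_integrand (node k) (probe \<epsilon> R T \<delta> k) p)) + initial_cone_distance \<epsilon> R"
    unfolding sum_distrib_left .
qed

text \<open>The average of the grid points stays in \<open>[0, 1]\<close>, so its total increase in space is at most \<open>1\<close>,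
uniformly in time and temperature.\<close>

lemma mean_x_integral:
  assumes "\<epsilon> > 0" "R \<ge> 0"
  shows "integrable lborel (\<lambda>y. mean_x \<epsilon> t y * indicator {-R..R} y)"
    and "(LINT y|lborel. mean_x \<epsilon> t y * indicator {-R..R} y) \<le> 1"
proof -
  let ?m = "\<lambda>y. \<Sum>k\<le>n. node k * weight \<epsilon> t y k"
  have *: "has_bochner_integral lborel (\<lambda>y. mean_x \<epsilon> t y * indicator {-R..R} y) (?m R - ?m (- R))"
    using assms
    by (intro has_bochner_integral_FTC_Icc_nonneg borel_measurable_continuous_onI[OF mean_x_continuous_y]
        mean_has_derivative_x mean_x_nonneg) auto
  have "?m R \<le> (\<Sum>k\<le>n. 1 * weight \<epsilon> t R k)"
    using node_in by (intro sum_mono mult_right_mono weight_nonneg) auto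
  moreover have "0 \<le> ?m (- R)"
    by (intro sum_nonneg mult_nonneg_nonneg weight_nonneg) auto
  ultimately have "?m R - ?m (- R) \<le> 1" by (simp add: sum_weight)
  with * show "integrable lborel (\<lambda>y. mean_x \<epsilon> t y * indicator {-R..R} y)"
    "(LINT y|lborel. mean_x \<epsilon> t y * indicator {-R..R} y) \<le> 1"
    by (auto simp: has_bochner_integral_iff)
qed

text \<open>The Kruzkov inequality integrated over the strip \<open>[0, T + \<delta>]\<close>.  Before time \<open>s\<close> only the crude bound
\<open>production_le_mean_x\<close> is used, at the price of a term of order \<open>s\<close>; afterwards the hypothesis \<open>prod\<close>
applies.  The lower bound \<open>A\<close> stands for the values of the distance in the time window, over which
the kernel averages.\<close>

lemma cone_distance_window_le:
  assumes pos: "\<epsilon> > 0" "\<delta> > 0" "T \<ge> 0" "R \<ge> 0" "s \<ge> 0" "E \<ge> 0" "K \<ge> 0"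
    and prod: "\<And>t y w. \<lbrakk>s \<le> t; w \<in> {0..1}\<rbrakk> \<Longrightarrow> production \<epsilon> t y w \<le> K * mean_x \<epsilon> t y + E"
    and A: "\<And>t. t \<in> {T..T + \<delta>} \<Longrightarrow> A \<le> cone_distance \<epsilon> R t"
  shows "A \<le> K * (T + \<delta>) + 4 * speed_bound * s + 2 * R * E * (T + \<delta>) + initial_cone_distance \<epsilon> R"
proof -
  define B where "B = {0..T + \<delta>} \<times> {-R..R}"
  define B' where "B' = {0..min s (T + \<delta>)} \<times> {-R..R}"
  define J where "J p = indicator half_plane p *
      (\<Sum>k\<le>n. kruzkov_integrand (node k) (probe \<epsilon> R T \<delta> k) p)" for p
  \<comment> \<open>\<open>F1\<close> is the density of the averaged distance, \<open>F2\<close> bounds the production after time \<open>s\<close> and \<open>F3\<close> the production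
    before time \<open>s\<close>; the integrand is at most \<open>- F1 + F2 + F3\<close>.\<close>
  define F1 where "F1 p = indicator half_plane p *
      (time_kernel T \<delta> (fst p) * (spread \<epsilon> (fst p) (snd p) (U p) * cone R (fst p) (snd p)))" for p
  define F2 where "F2 p = indicator B p *\<^sub>R (K * mean_x \<epsilon> (fst p) (snd p) + E)" for p
  define F3 where "F3 p = indicator B' p *\<^sub>R (4 * speed_bound * mean_x \<epsilon> (fst p) (snd p))" for p
  define V where "V p = - F1 p + F2 p + F3 p" for p
  have J: "integrable lborel J" "0 \<le> integral\<^sup>L lborel J + initial_cone_distance \<epsilon> R"
    using sum_kruzkov_inequality[OF pos(2,3)] unfolding J_def by auto
  have compact: "compact B" "compact B'"
    unfolding B_def B'_def by (intro compact_Times compact_Icc)+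
  have F2_int: "integrable lborel F2" and F3_int: "integrable lborel F3"
    unfolding F2_def[abs_def] F3_def[abs_def]
    by (intro borel_integrable_compact compact continuous_intros mean_x_continuous)+
  have F1_int: "integrable lborel F1"
  proof -
    have kc: "continuous_on S (\<lambda>p. time_kernel T \<delta> (fst p))" for S :: "(real \<times> real) set"
      by (intro continuous_on_compose2[OF time_kernel_continuous] continuous_intros) auto
    have [measurable]: "(\<lambda>p. time_kernel T \<delta> (fst p)) \<in> borel_measurable (borel :: (real \<times> real) measure)"
      "(\<lambda>p. weight \<epsilon> (fst p) (snd p) k) \<in> borel_measurable borel"
      "(\<lambda>p. cone R (fst p) (snd p)) \<in> borel_measurable borel" for k
      by (intro borel_measurable_continuous_onI kc weight_continuous cone_continuous)+
    have "integrable lborel (\<lambda>p. indicator B p *\<^sub>R time_kernel T \<delta> (fst p))"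
      by (intro borel_integrable_compact compact kc)
    then show ?thesis
    proof (rule Bochner_Integration.integrable_bound)
      show "F1 \<in> borel_measurable lborel"
        unfolding F1_def[abs_def] spread_def by measurable
      show "AE p in lborel. norm (F1 p) \<le> norm (indicator B p *\<^sub>R time_kernel T \<delta> (fst p))"
      proof (rule AE_I2)
        fix p :: "real \<times> real"
        obtain t y where p: "p = (t, y)" by (cases p)
        show "norm (F1 p) \<le> norm (indicator B p *\<^sub>R time_kernel T \<delta> (fst p))"
        proof (cases "p \<in> B")
          case True
          have "spread \<epsilon> t y (U p) * cone R t y \<le> 1"
            by (intro mult_le_one spread_le_1 U_range cone_range)
          then have "time_kernel T \<delta> t * (spread \<epsilon> t y (U p) * cone R t y) \<le> time_kernel T \<delta> t"
            using mult_left_mono[OF _ time_kernel_nonneg[OF pos(2)], of _ 1] by simp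
          then show ?thesis
            using True spread_nonneg cone_range time_kernel_nonneg[OF pos(2)]
            by (auto simp: F1_def p abs_mult indicator_def)
        next
          case False
          have "F1 p = 0"
          proof (cases "0 \<le> t \<and> t \<in> {T..T + \<delta>}")
            case True
            with False have "\<bar>y\<bar> > R" by (auto simp: B_def p)
            then show ?thesis using cone_outside'[of t R y] True by (simp add: F1_def p)
          next
            case False
            then show ?thesis
              using time_kernel_outside[OF pos(2)] pos(3) by (auto simp: F1_def p half_plane_def indicator_def)
          qed
          then show ?thesis by simp
        qed
      qed
    qed
  qed
  have V_int: "integrable lborel V"
    unfolding V_def[abs_def] using F1_int F2_int F3_int by simp
  have mxE: "0 \<le> K * mean_x \<epsilon> t y + E" "0 \<le> 4 * speed_bound * mean_x \<epsilon> t y" for t y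
    using pos mean_x_nonneg[OF pos(1)] speed_bound_nonneg by auto
  have F23: "0 \<le> F2 p + F3 p" for p
    unfolding F2_def F3_def real_scaleR_def
    by (intro add_nonneg_nonneg mult_nonneg_nonneg[OF _ mxE(1)] mult_nonneg_nonneg[OF _ mxE(2)]) auto
  have JV: "J p \<le> V p" for p
  proof (cases "p \<in> half_plane")
    case False
    then show ?thesis
      using mxE by (simp add: J_def V_def F1_def F2_def F3_def)
  next
    case True
    obtain t y where p: "p = (t, y)" by (cases p)
    have t: "t \<ge> 0" using True by (simp add: p half_plane_def)
    let ?C = "time_cutoff T \<delta> t * cone R t y"
    have C: "0 \<le> ?C" "?C \<le> 1"
      using time_cutoff_range cone_range by (auto intro: mult_le_one)
    have "?C * production \<epsilon> t y (U p) \<le> F2 p + F3 p"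
    proof (cases "p \<in> B")
      case False
      have "?C = 0"
      proof (cases "t \<le> T + \<delta>")
        case True
        with False t have "\<bar>y\<bar> > R" by (auto simp: B_def p)
        then show ?thesis using cone_outside'[OF t] by simp
      next
        case False
        then have "(T + \<delta> - t) / \<delta> \<le> 0" using pos(2) by (simp add: divide_le_0_iff)
        then show ?thesis by (simp add: time_cutoff_def g_zero)
      qed
      then show ?thesis using F23[of p] by (simp only: mult_zero_left)
    next
      case inB: True
      have "production \<epsilon> t y (U p) \<le> F2 p + F3 p"
      proof (cases "s \<le> t")
        case True
        then show ?thesis
          using prod[OF True U_range, of y p] mxE[of t y] inB
          by (simp add: F2_def F3_def p add_increasing2)
      next
        case False
        then have "p \<in> B'" using inB by (auto simp: B_def B'_def p)
        then show ?thesis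
          using production_le_mean_x[OF pos(1) U_range, of t y p] mxE[of t y] inB
          by (simp add: F2_def F3_def p)
      qed
      then show ?thesis
        using F23[of p] mult_left_mono[of "production \<epsilon> t y (U p)" "F2 p + F3 p" ?C] C
          mult_right_mono[of ?C 1 "F2 p + F3 p"] by simp
    qed
    then show ?thesis
      using sum_kruzkov_integrand_le[OF pos(2) t, of \<epsilon> R T y] True
      by (simp add: J_def V_def F1_def p)
  qed
  \<comment> \<open>A bound for the integral over space at a fixed time.\<close>
  define r where "r t = - (A * time_kernel T \<delta> t) + indicator {0..T + \<delta>} t *\<^sub>R (K + 2 * R * E)
      + indicator {0..s} t *\<^sub>R (4 * speed_bound)" for t
  have r: "has_bochner_integral lborel r
      (- (A * 1) + (T + \<delta>) * (K + 2 * R * E) + s * (4 * speed_bound))"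
  proof -
    have "has_bochner_integral lborel (\<lambda>t. indicator {0..b} t *\<^sub>R c) (b * c)" if "b \<ge> 0" for b c :: real
      using that has_bochner_integral_indicator[of "{0..b}" lborel c] by simp
    then show ?thesis
      unfolding r_def[abs_def] using pos
      by (intro has_bochner_integral_add has_bochner_integral_minus has_bochner_integral_mult_right
          time_kernel_integral) auto
  qed
  have slice: "(LINT y|lborel. V (t, y)) \<le> r t" for t
  proof (cases "t \<ge> 0")
    case False
    then have "V (t, y) = 0" for y
      by (auto simp: V_def F1_def F2_def F3_def half_plane_def B_def B'_def indicator_def)
    moreover have "r t = 0"
      using False pos time_kernel_outside[OF pos(2), of t T] by (auto simp: r_def indicator_def)
    ultimately show ?thesis by simp
  next
    case True
    let ?i = "indicator {0..T + \<delta>} t :: real" and ?j = "indicator {0..min s (T + \<delta>)} t :: real"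
    let ?m = "\<lambda>y. mean_x \<epsilon> t y * indicator {-R..R} y" and ?s = "\<lambda>y. spread \<epsilon> t y (U (t, y)) * cone R t y"
    have m: "integrable lborel ?m" "integral\<^sup>L lborel ?m \<le> 1"
      using mean_x_integral[OF pos(1,4)] by auto
    have s: "integrable lborel ?s"
      by (intro spread_cone_integrable True U_section_measurable U_range)
    have I: "integrable lborel (\<lambda>y. indicator {-R..R} y :: real)" "(LINT y|lborel. indicator {-R..R} y) = 2 * R"
      using pos(4) by auto
    have "V (t, y) = - (time_kernel T \<delta> t * ?s y) + ?i * (K * ?m y + E * indicator {-R..R} y)
        + ?j * (4 * speed_bound * ?m y)" for y
      using True by (auto simp: V_def F1_def F2_def F3_def half_plane_def B_def B'_def indicator_def)
    then have "(LINT y|lborel. V (t, y)) = - (time_kernel T \<delta> t * cone_distance \<epsilon> R t)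
        + ?i * (K * integral\<^sup>L lborel ?m + E * (2 * R)) + ?j * (4 * speed_bound * integral\<^sup>L lborel ?m)"
      using m s I by (simp add: cone_distance_def)
    also have "\<dots> \<le> - (time_kernel T \<delta> t * A) + ?i * (K * 1 + E * (2 * R)) + indicator {0..s} t * (4 * speed_bound * 1)"
    proof (intro add_mono)
      show "- (time_kernel T \<delta> t * cone_distance \<epsilon> R t) \<le> - (time_kernel T \<delta> t * A)"
        using A[of t] time_kernel_outside[OF pos(2), of t T] time_kernel_nonneg[OF pos(2), of T t]
        by (cases "t \<in> {T..T + \<delta>}") (auto intro: mult_left_mono)
      show "?i * (K * integral\<^sup>L lborel ?m + E * (2 * R)) \<le> ?i * (K * 1 + E * (2 * R))"
        using m(2) pos by (intro mult_left_mono add_right_mono) auto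
      have "0 \<le> integral\<^sup>L lborel ?m" using mean_x_nonneg[OF pos(1)] by simp
      then show "?j * (4 * speed_bound * integral\<^sup>L lborel ?m) \<le> indicator {0..s} t * (4 * speed_bound * 1)"
        using m(2) speed_bound_nonneg by (intro mult_mono) (auto simp: indicator_def)
    qed
    also have "\<dots> = r t" by (simp add: r_def algebra_simps)
    finally show ?thesis .
  qed
  have V_prod: "integrable (lborel \<Otimes>\<^sub>M lborel) V" using V_int by (simp add: lborel_prod)
  have "integral\<^sup>L lborel V = (LINT t|lborel. LINT y|lborel. V (t, y))"
    using lborel_pair.integral_fst'[OF V_prod] by (simp add: lborel_prod)
  also have "\<dots> \<le> integral\<^sup>L lborel r"
    using r lborel_pair.integrable_fst'[OF V_prod] slice
    by (intro integral_mono) (auto simp: has_bochner_integral_iff)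
  also have "\<dots> = - A + (T + \<delta>) * (K + 2 * R * E) + s * (4 * speed_bound)"
    using r by (simp add: has_bochner_integral_iff)
  finally have "integral\<^sup>L lborel V \<le> - A + (T + \<delta>) * (K + 2 * R * E) + s * (4 * speed_bound)" .
  moreover have "integral\<^sup>L lborel J \<le> integral\<^sup>L lborel V"
    using J(1) V_int JV by (intro integral_mono) auto
  ultimately show ?thesis using J(2) by (simp add: algebra_simps)
qed

end

section \<open>The limit of zero temperature\<close>

context kruzkov_setting
begin

lemma spread_difference_le:
  assumes "w \<in> {0..1}"
  shows "spread \<epsilon> t y w * c - spread \<epsilon> s y v * d
    \<le> (\<Sum>k\<le>n. \<bar>weight \<epsilon> t y k * c - weight \<epsilon> s y k * d\<bar>) + \<bar>d\<bar> * \<bar>w - v\<bar>"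
proof -
  have "weight \<epsilon> t y k * \<bar>w - node k\<bar> * c - weight \<epsilon> s y k * \<bar>v - node k\<bar> * d
      \<le> \<bar>weight \<epsilon> t y k * c - weight \<epsilon> s y k * d\<bar> + weight \<epsilon> s y k * (\<bar>d\<bar> * \<bar>w - v\<bar>)" if "k \<le> n" for k
  proof -
    let ?a = "weight \<epsilon> t y k * c" and ?b = "weight \<epsilon> s y k * d"
    have w: "\<bar>w - node k\<bar> \<le> 1"
      using node_in[OF that] assms by (simp only: atLeastAtMost_iff) linarith
    have "weight \<epsilon> t y k * \<bar>w - node k\<bar> * c - weight \<epsilon> s y k * \<bar>v - node k\<bar> * d
       = (?a - ?b) * \<bar>w - node k\<bar> + ?b * (\<bar>w - node k\<bar> - \<bar>v - node k\<bar>)"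
      by (simp add: algebra_simps)
    also have "\<dots> \<le> \<bar>?a - ?b\<bar> * 1 + \<bar>?b\<bar> * \<bar>w - v\<bar>"
    proof (intro add_mono)
      show "(?a - ?b) * \<bar>w - node k\<bar> \<le> \<bar>?a - ?b\<bar> * 1"
        using w by (intro mult_mono) auto
      have "?b * (\<bar>w - node k\<bar> - \<bar>v - node k\<bar>) \<le> \<bar>?b * (\<bar>w - node k\<bar> - \<bar>v - node k\<bar>)\<bar>"
        by (rule abs_ge_self)
      also have "\<dots> \<le> \<bar>?b\<bar> * \<bar>w - v\<bar>"
        unfolding abs_mult[of ?b] by (intro mult_left_mono) auto
      finally show "?b * (\<bar>w - node k\<bar> - \<bar>v - node k\<bar>) \<le> \<bar>?b\<bar> * \<bar>w - v\<bar>" .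
    qed
    finally show ?thesis
      using weight_nonneg[of \<epsilon> s y k] by (simp add: abs_mult)
  qed
  then have "spread \<epsilon> t y w * c - spread \<epsilon> s y v * d
     \<le> (\<Sum>k\<le>n. \<bar>weight \<epsilon> t y k * c - weight \<epsilon> s y k * d\<bar> + weight \<epsilon> s y k * (\<bar>d\<bar> * \<bar>w - v\<bar>))"
    unfolding spread_def sum_distrib_right sum_subtractf[symmetric] by (intro sum_mono) auto
  also have "\<dots> = (\<Sum>k\<le>n. \<bar>weight \<epsilon> t y k * c - weight \<epsilon> s y k * d\<bar>) + \<bar>d\<bar> * \<bar>w - v\<bar>"
    unfolding sum.distrib sum_distrib_right[symmetric] sum_weight by simp
  finally show ?thesis .
qed

text \<open>The solution is continuous in time in the local \<open>L1\<close> sense, the weights and the cone are uniformly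
continuous on compact sets.\<close>

lemma cone_distance_right_continuous:
  assumes "T \<ge> 0" "R \<ge> 0" "\<eta> > 0"
  obtains \<delta> where "\<delta> > 0" "\<And>t. t \<in> {T..T + \<delta>} \<Longrightarrow> cone_distance \<epsilon> R T - \<eta> \<le> cone_distance \<epsilon> R t"
proof -
  \<comment> \<open>The denominator uses \<open>2 * R + 1\<close> rather than \<open>2 * R\<close>, which may be \<open>0\<close>.\<close>
  define \<mu> where "\<mu> = \<eta> / (2 * (2 * R + 1))"
  have \<mu>: "\<mu> > 0" "2 * R * \<mu> \<le> \<eta> / 2" using assms by (auto simp: \<mu>_def field_simps)
  define \<Phi> where "\<Phi> p = (\<Sum>k\<le>n. \<bar>weight \<epsilon> T (snd p) k * cone R T (snd p)
      - weight \<epsilon> (fst p) (snd p) k * cone R (fst p) (snd p)\<bar>)" for p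
  have "continuous_on ({T..T + 1} \<times> {-R..R}) \<Phi>"
    unfolding \<Phi>_def
    by (intro continuous_intros weight_continuous cone_continuous
        continuous_on_compose2[OF weight_continuous_y[of UNIV]] continuous_on_compose2[OF cone_continuous_y[of UNIV]]) auto
  then have "uniformly_continuous_on ({T..T + 1} \<times> {-R..R}) \<Phi>"
    by (intro compact_uniformly_continuous compact_Times compact_Icc)
  from this[unfolded uniformly_continuous_on_def, rule_format, OF \<mu>(1)]
  obtain \<delta>1 where \<delta>1: "\<delta>1 > 0" "\<And>p q. \<lbrakk>p \<in> {T..T + 1} \<times> {-R..R}; q \<in> {T..T + 1} \<times> {-R..R}; dist q p < \<delta>1\<rbrakk>
      \<Longrightarrow> dist (\<Phi> q) (\<Phi> p) < \<mu>" by blast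
  have \<Phi>_small: "\<Phi> (t, y) < \<mu>" if "t \<in> {T..T + 1}" "t < T + \<delta>1" "y \<in> {-R..R}" for t y
  proof -
    have "dist (\<Phi> (t, y)) (\<Phi> (T, y)) < \<mu>"
      using that by (intro \<delta>1(2)) (auto simp: dist_Pair_Pair dist_real_def)
    then show ?thesis by (simp add: \<Phi>_def[of "(T, y)"] dist_real_def)
  qed
  have "continuous_in_L1_loc u" using entropy by (simp add: entropy_solution_def)
  then have "((\<lambda>s. LINT y:{-R..R}|lborel. \<bar>u s y - u T y\<bar>) \<longlongrightarrow> 0) (at T within {0..})"
    using assms(1) by (simp add: continuous_in_L1_loc_def)
  from tendstoD[OF this, of "\<eta> / 2"] assms(3)
  obtain \<delta>2 where \<delta>2: "\<delta>2 > 0" "\<And>s. \<lbrakk>s \<in> {0..}; s \<noteq> T; dist s T < \<delta>2\<rbrakk>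
      \<Longrightarrow> dist (LINT y:{-R..R}|lborel. \<bar>u s y - u T y\<bar>) 0 < \<eta> / 2"
    by (auto simp: eventually_at)
  define \<delta> where "\<delta> = min 1 (min \<delta>1 \<delta>2) / 2"
  have \<delta>: "\<delta> > 0" "\<delta> < 1" "\<delta> < \<delta>1" "\<delta> < \<delta>2" using \<delta>1(1) \<delta>2(1) by (auto simp: \<delta>_def)
  have "cone_distance \<epsilon> R T - \<eta> \<le> cone_distance \<epsilon> R t" if t: "t \<in> {T..T + \<delta>}" for t
  proof -
    have t0: "t \<ge> 0" using t assms(1) by simp
    have L1: "(LINT y:{-R..R}|lborel. \<bar>u t y - u T y\<bar>) \<le> \<eta> / 2"
    proof (cases "t = T")
      case True
      then show ?thesis using assms(3) by (simp add: set_lebesgue_integral_def)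
    next
      case False
      then show ?thesis using \<delta>2(2)[of t] t t0 \<delta> by (auto simp: dist_real_def)
    qed
    let ?F = "\<lambda>s y. spread \<epsilon> s y (U (s, y)) * cone R s y"
    let ?D = "\<lambda>y. indicator {-R..R} y *\<^sub>R \<bar>u t y - u T y\<bar>"
    have Fint: "integrable lborel (?F s)" if "s \<ge> 0" for s
      by (intro spread_cone_integrable that U_section_measurable U_range)
    have box: "integrable lborel (\<lambda>y. indicator {-R..R} y *\<^sub>R (c::real))" for c
      by (rule borel_integrable_compact) auto
    have Dint: "integrable lborel ?D"
    proof (rule Bochner_Integration.integrable_bound[OF box[of 1]])
      have [measurable]: "u t \<in> borel_measurable borel" "u T \<in> borel_measurable borel"
        using U_section_measurable[of t] U_section_measurable[of T] t0 assms(1) by (simp_all add: U_eq)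
      show "?D \<in> borel_measurable lborel" by measurable
      have "\<bar>u t y - u T y\<bar> \<le> 1" for y
        using U_range[of "(t, y)"] U_range[of "(T, y)"] t0 assms(1) by (auto simp: U_eq)
      then show "AE y in lborel. norm (?D y) \<le> norm (indicator {-R..R} y *\<^sub>R (1::real))"
        by (auto simp: indicator_def)
    qed
    have "cone_distance \<epsilon> R T - cone_distance \<epsilon> R t = (LINT y|lborel. ?F T y - ?F t y)"
      unfolding cone_distance_def using Fint t0 assms(1) by (subst Bochner_Integration.integral_diff) auto
    also have "\<dots> \<le> (LINT y|lborel. indicator {-R..R} y *\<^sub>R \<mu> + ?D y)"
    proof (rule integral_mono)
      show "integrable lborel (\<lambda>y. ?F T y - ?F t y)" using Fint t0 assms(1) by auto
      show "integrable lborel (\<lambda>y. indicator {-R..R} y *\<^sub>R \<mu> + ?D y)" using box Dint by auto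
      show "?F T y - ?F t y \<le> indicator {-R..R} y *\<^sub>R \<mu> + ?D y" for y
      proof (cases "y \<in> {-R..R}")
        case True
        have "?F T y - ?F t y \<le> \<Phi> (t, y) + \<bar>cone R t y\<bar> * \<bar>U (T, y) - U (t, y)\<bar>"
          unfolding \<Phi>_def fst_conv snd_conv by (rule spread_difference_le[OF U_range])
        also have "\<dots> \<le> \<mu> + 1 * \<bar>U (T, y) - U (t, y)\<bar>"
        proof (intro add_mono mult_right_mono)
          show "\<Phi> (t, y) \<le> \<mu>" using \<Phi>_small[of t y] True t \<delta> by auto
        qed (use cone_range[of R t y] in auto)
        finally show ?thesis
          using True t0 assms(1) by (simp add: U_eq abs_minus_commute)
      next
        case False
        then have "cone R T y = 0" "cone R t y = 0"
          using assms(1) t0 by (auto intro!: cone_outside')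
        then show ?thesis using \<mu>(1) by (simp add: indicator_def)
      qed
    qed
    also have "\<dots> = 2 * R * \<mu> + (LINT y:{-R..R}|lborel. \<bar>u t y - u T y\<bar>)"
      using box Dint assms(2) by (simp add: set_lebesgue_integral_def)
    finally show ?thesis using L1 \<mu>(2) by linarith
  qed
  with \<delta>(1) show ?thesis by (rule that)
qed

text \<open>By right continuity the time window may shrink to the single time \<open>T\<close>.\<close>

lemma cone_distance_le:
  assumes pos: "\<epsilon> > 0" "T \<ge> 0" "R \<ge> 0" "s \<ge> 0" "E \<ge> 0" "K \<ge> 0"
    and prod: "\<And>t y w. \<lbrakk>s \<le> t; w \<in> {0..1}\<rbrakk> \<Longrightarrow> production \<epsilon> t y w \<le> K * mean_x \<epsilon> t y + E"
  shows "cone_distance \<epsilon> R T \<le> K * T + 4 * speed_bound * s + 2 * R * E * (T + 1) + initial_cone_distance \<epsilon> R"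
proof (rule field_le_epsilon)
  fix e :: real assume e: "e > 0"
  obtain \<delta> where \<delta>: "\<delta> > 0" "\<And>t. t \<in> {T..T + \<delta>} \<Longrightarrow> cone_distance \<epsilon> R T - e / 2 \<le> cone_distance \<epsilon> R t"
    using cone_distance_right_continuous[OF pos(2,3), of "e / 2" \<epsilon>] e by auto
  define d where "d = min (min \<delta> 1) (e / (2 * (K + 1)))"
  have d: "d > 0" "d \<le> \<delta>" "d \<le> 1" "K * d \<le> e / 2"
  proof -
    show "d > 0" "d \<le> \<delta>" "d \<le> 1" using \<delta>(1) e pos by (auto simp: d_def)
    have "K * d \<le> (K + 1) * (e / (2 * (K + 1)))"
      using pos(6) e \<delta>(1) by (intro mult_mono) (auto simp: d_def)
    also have "\<dots> = e / 2"
    proof -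
      have "K + 1 > 0" using pos(6) by simp
      then show ?thesis by (simp add: divide_simps)
    qed
    finally show "K * d \<le> e / 2" .
  qed
  have "cone_distance \<epsilon> R T - e / 2 \<le> K * (T + d) + 4 * speed_bound * s + 2 * R * E * (T + d) + initial_cone_distance \<epsilon> R"
    using d(2) by (intro cone_distance_window_le pos d(1) prod \<delta>(2)) auto
  also have "2 * R * E * (T + d) \<le> 2 * R * E * (T + 1)"
    using pos d by (intro mult_left_mono) auto
  finally show "cone_distance \<epsilon> R T \<le> K * T + 4 * speed_bound * s + 2 * R * E * (T + 1) + initial_cone_distance \<epsilon> R + e"
    using d(4) by (simp add: distrib_left)
qed

text \<open>A unique maximiser of the energy attracts the whole weight as the temperature vanishes.\<close>

lemma spread_tendsto:
  assumes K: "K \<le> n" "\<And>k. \<lbrakk>k \<le> n; k \<noteq> K\<rbrakk> \<Longrightarrow> energy t y k < energy t y K"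
    and \<epsilon>: "\<And>j. \<epsilon> j > 0" "\<epsilon> \<longlonglongrightarrow> 0"
  shows "(\<lambda>j. spread (\<epsilon> j) t y w) \<longlonglongrightarrow> \<bar>w - node K\<bar>"
proof -
  have other: "(\<lambda>j. weight (\<epsilon> j) t y k) \<longlonglongrightarrow> 0" if k: "k \<le> n" "k \<noteq> K" for k
  proof (rule tendsto_sandwich[OF _ _ tendsto_const])
    have "filterlim (\<lambda>j. inverse (\<epsilon> j)) at_top sequentially"
      using \<epsilon> by (intro filterlim_inverse_at_top) auto
    then have "filterlim (\<lambda>j. (energy t y k - energy t y K) * inverse (\<epsilon> j)) at_bot sequentially"
      using K(2)[OF k] by (subst filterlim_tendsto_neg_mult_at_bot_iff[OF tendsto_const]) auto
    then show "(\<lambda>j. exp ((energy t y k - energy t y K) * inverse (\<epsilon> j))) \<longlonglongrightarrow> 0"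
      by (rule filterlim_compose[OF exp_at_bot])
    show "\<forall>\<^sub>F j in sequentially. 0 \<le> weight (\<epsilon> j) t y k" by (simp add: weight_nonneg)
    have "weight (\<epsilon> j) t y k \<le> exp (energy t y k / \<epsilon> j - energy t y K / \<epsilon> j)" for j
      unfolding weight_def by (rule gibbs_le_exp_diff[OF K(1)])
    then show "\<forall>\<^sub>F j in sequentially. weight (\<epsilon> j) t y k
        \<le> exp ((energy t y k - energy t y K) * inverse (\<epsilon> j))"
      by (simp add: divide_inverse left_diff_distrib)
  qed
  have "(\<lambda>j. 1 - (\<Sum>k\<in>{..n} - {K}. weight (\<epsilon> j) t y k)) \<longlonglongrightarrow> 1 - (\<Sum>k\<in>{..n} - {K}. 0)"
    by (intro tendsto_intros other) auto
  moreover have "1 - (\<Sum>k\<in>{..n} - {K}. weight (\<epsilon> j) t y k) = weight (\<epsilon> j) t y K" for j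
    using sum_weight[of "\<epsilon> j" t y] K(1) by (simp add: sum.remove[of "{..n}" K])
  ultimately have "(\<lambda>j. weight (\<epsilon> j) t y K) \<longlonglongrightarrow> 1" by simp
  then have "(\<lambda>j. weight (\<epsilon> j) t y k) \<longlonglongrightarrow> (if k = K then 1 else 0)" if "k \<le> n" for k
    using other[OF that] by simp
  then have "(\<lambda>j. spread (\<epsilon> j) t y w) \<longlonglongrightarrow> (\<Sum>k\<le>n. (if k = K then 1 else 0) * \<bar>w - node k\<bar>)"
    unfolding spread_def by (intro tendsto_sum tendsto_mult tendsto_const) auto
  also have "(\<Sum>k\<le>n. (if k = K then 1 else 0) * \<bar>w - node k\<bar>) = \<bar>w - node K\<bar>"
    using K(1) by (simp add: if_distrib[of "\<lambda>z. z * _"] cong: if_cong)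
  finally show ?thesis .
qed

lemma spread_cone_integral_tendsto:
  assumes t: "t \<ge> 0" and [measurable]: "w \<in> borel_measurable borel" "v \<in> borel_measurable borel"
    and w: "\<And>y. w y \<in> {0..1}" and "finite N"
    and v: "\<And>y. y \<notin> N \<Longrightarrow> \<exists>K\<le>n. v y = node K \<and> (\<forall>k\<le>n. k \<noteq> K \<longrightarrow> energy t y k < energy t y K)"
    and \<epsilon>: "\<And>j. \<epsilon> j > 0" "\<epsilon> \<longlonglongrightarrow> 0"
  shows "(\<lambda>j. LINT y|lborel. spread (\<epsilon> j) t y (w y) * cone R t y)
      \<longlonglongrightarrow> (LINT y|lborel. \<bar>w y - v y\<bar> * cone R t y)"
    and "integrable lborel (\<lambda>y. \<bar>w y - v y\<bar> * cone R t y)"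
proof -
  have [measurable]: "cone R t \<in> borel_measurable borel"
    by (rule borel_measurable_continuous_onI[OF cone_continuous_y])
  have box: "integrable lborel (\<lambda>y. indicator {-R..R} y *\<^sub>R (1::real))"
    by (rule borel_integrable_compact) auto
  have "AE y in lborel. y \<notin> N"
    by (intro AE_not_in finite_imp_null_set_lborel \<open>finite N\<close>)
  then have lim: "AE y in lborel. (\<lambda>j. spread (\<epsilon> j) t y (w y) * cone R t y) \<longlonglongrightarrow> \<bar>w y - v y\<bar> * cone R t y"
  proof eventually_elim
    case (elim y)
    from v[OF elim] obtain K where "K \<le> n" "v y = node K"
      "\<And>k. \<lbrakk>k \<le> n; k \<noteq> K\<rbrakk> \<Longrightarrow> energy t y k < energy t y K" by blast
    then show ?case
      using spread_tendsto[OF _ _ \<epsilon>, of K t y "w y"] by (auto intro: tendsto_mult)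
  qed
  have bound: "AE y in lborel. norm (spread (\<epsilon> j) t y (w y) * cone R t y) \<le> indicator {-R..R} y *\<^sub>R (1::real)" for j
  proof (rule AE_I2)
    fix y
    show "norm (spread (\<epsilon> j) t y (w y) * cone R t y) \<le> indicator {-R..R} y *\<^sub>R (1::real)"
    proof (cases "y \<in> {-R..R}")
      case True
      then show ?thesis
        using mult_le_one[OF spread_le_1[OF w] cone_range] spread_nonneg cone_range
        by (simp add: abs_mult)
    next
      case False
      then have "cone R t y = 0" by (intro cone_outside' t) auto
      then show ?thesis by simp
    qed
  qed
  have meas: "(\<lambda>y. spread (\<epsilon> j) t y (w y) * cone R t y) \<in> borel_measurable lborel" for j
    using spread_cone_integrable[OF t _ w] by (intro borel_measurable_integrable) auto
  have meas': "(\<lambda>y. \<bar>w y - v y\<bar> * cone R t y) \<in> borel_measurable lborel" by measurable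
  show "(\<lambda>j. LINT y|lborel. spread (\<epsilon> j) t y (w y) * cone R t y)
      \<longlonglongrightarrow> (LINT y|lborel. \<bar>w y - v y\<bar> * cone R t y)"
    by (rule integral_dominated_convergence[OF meas' meas box lim bound])
  show "integrable lborel (\<lambda>y. \<bar>w y - v y\<bar> * cone R t y)"
    by (rule integrable_dominated_convergence[OF meas' meas box lim bound])
qed

text \<open>At time \<open>0\<close> the maximiser is read off from the ordered initial positions, so the Gibbs
approximation starts from the initial datum of the solution.\<close>

lemma energy_argmax_initial:
  assumes "y \<notin> x ` {1..n}"
  shows "\<exists>K\<le>n. u0 y = node K \<and> (\<forall>k\<le>n. k \<noteq> K \<longrightarrow> energy 0 y k < energy 0 y K)"
proof -
  define K where "K = card {k \<in> {1..n}. x k \<le> y}"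
  have "K \<le> card {1..n}" unfolding K_def by (intro card_mono) auto
  moreover have "energy 0 y k < energy 0 y K" if "k \<le> n" "k \<noteq> K" for k
  proof -
    have e: "energy 0 y k = (\<Sum>j=1..k. y - x j) / real n" for k
      by (simp add: energy_def sum_subtractf diff_divide_distrib)
    show ?thesis
      unfolding e using partial_sums_argmax[OF x_mono assms K_def that] n_pos
      by (simp add: divide_strict_right_mono)
  qed
  ultimately show ?thesis unfolding u0_eq K_def[symmetric] by auto
qed

text \<open>Integrating \<open>lam\<close> over cells turns the partial sums of the velocities into values of \<open>\<Lambda>\<close>, so the
energies are the functional of \<open>sticky_argmax\<close>.\<close>

lemma energy_argmax:
  assumes "y \<notin> sticky_position n (mean_velocity lam n) x t ` {1..n}"
  shows "\<exists>K\<le>n. sticky_cdf lam n x t y = node K \<and> (\<forall>k\<le>n. k \<noteq> K \<longrightarrow> energy t y k < energy t y K)"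
proof -
  let ?p = "sticky_position n (mean_velocity lam n) x t"
  define K where "K = card {k \<in> {1..n}. ?p k \<le> y}"
  have "K \<le> card {1..n}" unfolding K_def by (intro card_mono) auto
  then have Kn: "K \<le> n" by simp
  have e: "energy t y k = (real k * y - (\<Sum>j=1..k. x j + t * mean_velocity lam n j)) / real n - t * \<Lambda> 0"
    if "k \<le> n" for k
  proof -
    have "(\<Sum>j=1..k. x j + t * mean_velocity lam n j) = (\<Sum>j=1..k. x j) + t * (real n * (\<Lambda> (node k) - \<Lambda> 0))"
      unfolding sum.distrib sum_distrib_left[symmetric] sum_mean_velocity[OF n_pos that] ..
    then show ?thesis using n_pos by (simp add: energy_def field_simps)
  qed
  have "energy t y k < energy t y K" if "k \<le> n" "k \<noteq> K" for k
    unfolding e[OF that(1)] e[OF Kn]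
    using sticky_argmax[OF n_pos assms K_def that] n_pos by (simp add: divide_strict_right_mono)
  then show ?thesis unfolding sticky_cdf_eq_card K_def[symmetric] using Kn by auto
qed

lemma sticky_cdf_measurable [measurable]: "sticky_cdf lam n x t \<in> borel_measurable borel"
proof -
  have "indicator {..y} c = (indicator {c..} y :: real)" for c y :: real
    by (simp add: indicator_def)
  then show ?thesis unfolding sticky_cdf_def[abs_def] by simp
qed

lemma localized_distance_le:
  assumes T: "T \<ge> 0" and R: "R \<ge> 0"
  shows "integrable lborel (\<lambda>y. \<bar>U (T, y) - sticky_cdf lam n x T y\<bar> * cone R T y)"
    and "(LINT y|lborel. \<bar>U (T, y) - sticky_cdf lam n x T y\<bar> * cone R T y) \<le> L / (2 * real n) * T"
proof -
  define C where "C = 2 * speed_bound * (real n + 1)\<^sup>2"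
  obtain \<kappa> where \<kappa>: "\<kappa> > 0" "\<And>\<epsilon> s t y u. \<lbrakk>\<epsilon> > 0; 0 \<le> s; s \<le> t; u \<in> {0..1}\<rbrakk> \<Longrightarrow>
       production \<epsilon> t y u \<le> L / (2 * real n) * mean_x \<epsilon> t y + C * (exp (- (s * \<kappa> / \<epsilon>)) / \<epsilon>)"
    unfolding C_def by (rule production_le) blast
  \<comment> \<open>The initial layer \<open>[0, s]\<close> shrinks, but slower than the temperature: \<open>s / \<epsilon>\<close> must tend to
    infinity fast enough for \<open>exp (- s * \<kappa> / \<epsilon>) / \<epsilon>\<close> to vanish.\<close>
  define \<epsilon> s :: "nat \<Rightarrow> real" where "\<epsilon> j = 1 / (real j + 1) ^ 2" and "s j = 1 / (real j + 1)" for j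
  define E where "E j = C * (exp (- (s j * \<kappa> / \<epsilon> j)) / \<epsilon> j)" for j
  have \<epsilon>: "\<epsilon> j > 0" for j by (simp add: \<epsilon>_def)
  have C: "C \<ge> 0" using speed_bound_nonneg by (simp add: C_def)
  have \<epsilon>_lim: "\<epsilon> \<longlonglongrightarrow> 0" and s_lim: "s \<longlonglongrightarrow> 0"
    unfolding \<epsilon>_def s_def by real_asymp+
  have "s j * \<kappa> / \<epsilon> j = \<kappa> * (real j + 1)" for j
    by (simp add: s_def \<epsilon>_def power2_eq_square)
  then have "E = (\<lambda>j. C * (exp (- (\<kappa> * (real j + 1))) * (real j + 1) ^ 2))"
    by (simp add: E_def \<epsilon>_def fun_eq_iff)
  moreover have "(\<lambda>j. exp (- (\<kappa> * (real j + 1))) * (real j + 1) ^ 2) \<longlonglongrightarrow> 0"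
    using \<kappa>(1) by real_asymp
  ultimately have E_lim: "E \<longlonglongrightarrow> 0" by (auto intro: tendsto_mult_right_zero)
  have bound: "cone_distance (\<epsilon> j) R T \<le> L / (2 * real n) * T + 4 * speed_bound * s j + 2 * R * E j * (T + 1)
      + initial_cone_distance (\<epsilon> j) R" for j
  proof (rule cone_distance_le)
    show "0 \<le> s j" by (simp add: s_def)
    then show "production (\<epsilon> j) t y w \<le> L / (2 * real n) * mean_x (\<epsilon> j) t y + E j"
      if "s j \<le> t" "w \<in> {0..1}" for t y w
      unfolding E_def using that \<epsilon> by (intro \<kappa>(2)) auto
    show "0 \<le> E j" unfolding E_def using C \<epsilon>[of j] by simp
  qed (use \<epsilon> T R L_nonneg in auto)
  have "initial_cone_distance (\<epsilon> j) R = (LINT y|lborel. spread (\<epsilon> j) 0 y (u0 y) * cone R 0 y)" for j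
    by (simp add: initial_cone_distance_def)
  moreover have "(\<lambda>j. LINT y|lborel. spread (\<epsilon> j) 0 y (u0 y) * cone R 0 y)
      \<longlonglongrightarrow> (LINT y|lborel. \<bar>u0 y - u0 y\<bar> * cone R 0 y)"
    by (rule spread_cone_integral_tendsto(1)[where N = "x ` {1..n}"])
       (use u0_range energy_argmax_initial \<epsilon> \<epsilon>_lim in auto)
  ultimately have i_lim: "(\<lambda>j. initial_cone_distance (\<epsilon> j) R) \<longlonglongrightarrow> 0" by simp
  have g_lim: "(\<lambda>j. cone_distance (\<epsilon> j) R T) \<longlonglongrightarrow> (LINT y|lborel. \<bar>U (T, y) - sticky_cdf lam n x T y\<bar> * cone R T y)"
    unfolding cone_distance_def
    by (rule spread_cone_integral_tendsto(1)[where N = "sticky_position n (mean_velocity lam n) x T ` {1..n}"])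
       (use T U_range energy_argmax \<epsilon> \<epsilon>_lim in auto)
  show "integrable lborel (\<lambda>y. \<bar>U (T, y) - sticky_cdf lam n x T y\<bar> * cone R T y)"
    by (rule spread_cone_integral_tendsto(2)[where N = "sticky_position n (mean_velocity lam n) x T ` {1..n}"])
       (use T U_range energy_argmax \<epsilon> \<epsilon>_lim in auto)
  have "(\<lambda>j. L / (2 * real n) * T + 4 * speed_bound * s j + 2 * R * E j * (T + 1) + initial_cone_distance (\<epsilon> j) R)
      \<longlonglongrightarrow> L / (2 * real n) * T + 4 * speed_bound * 0 + 2 * R * 0 * (T + 1) + 0"
    by (intro tendsto_intros s_lim E_lim i_lim)
  then show "(LINT y|lborel. \<bar>U (T, y) - sticky_cdf lam n x T y\<bar> * cone R T y) \<le> L / (2 * real n) * T"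
    using LIMSEQ_le[OF g_lim] bound by fastforce
qed

text \<open>The cone with \<open>R = r + 1 + speed_bound * T\<close> equals \<open>1\<close> on \<open>[-r, r]\<close> at time \<open>T\<close>; then \<open>r\<close> tends to
infinity.\<close>

lemma distance_le:
  assumes T: "T \<ge> 0"
  shows "(\<integral>\<^sup>+ y. ennreal \<bar>u T y - sticky_cdf lam n x T y\<bar> \<partial>lborel) \<le> ennreal (L / (2 * real n) * T)"
proof -
  let ?f = "\<lambda>y. \<bar>U (T, y) - sticky_cdf lam n x T y\<bar>"
  let ?F = "\<lambda>(r::nat) y. ennreal (?f y) * indicator {- real r..real r} y"
  have [measurable]: "(\<lambda>y. U (T, y)) \<in> borel_measurable borel" by (rule U_section_measurable)
  have part: "(\<integral>\<^sup>+ y. ?F r y \<partial>lborel) \<le> ennreal (L / (2 * real n) * T)" for r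
  proof -
    define R where "R = real r + 1 + speed_bound * T"
    have R: "R \<ge> 0" using T speed_bound_nonneg by (simp add: R_def)
    have "?F r y \<le> ennreal (?f y * cone R T y)" for y
    proof (cases "y \<in> {- real r..real r}")
      case True
      then have "cone R T y = 1" by (simp add: cone_def R_def g_one)
      then show ?thesis using True by simp
    qed simp
    then have "(\<integral>\<^sup>+ y. ?F r y \<partial>lborel) \<le> (\<integral>\<^sup>+ y. ennreal (?f y * cone R T y) \<partial>lborel)"
      by (intro nn_integral_mono)
    also have "\<dots> = ennreal (LINT y|lborel. ?f y * cone R T y)"
      using localized_distance_le(1)[OF T R] cone_range by (intro nn_integral_eq_integral) auto
    also have "\<dots> \<le> ennreal (L / (2 * real n) * T)"
      by (intro ennreal_leI localized_distance_le(2) T R)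
    finally show ?thesis .
  qed
  have inc: "incseq ?F"
    by (auto simp: incseq_def le_fun_def indicator_def)
  have sup: "(SUP r. ?F r y) = ennreal (?f y)" for y
  proof (rule antisym)
    show "(SUP r. ?F r y) \<le> ennreal (?f y)"
      by (intro SUP_least) (simp add: indicator_def)
    obtain r :: nat where "\<bar>y\<bar> \<le> real r" using real_arch_simple by blast
    then have "ennreal (?f y) = ?F r y" by (auto simp: indicator_def)
    also have "\<dots> \<le> (SUP r. ?F r y)" by (rule SUP_upper) simp
    finally show "ennreal (?f y) \<le> (SUP r. ?F r y)" .
  qed
  have "(\<integral>\<^sup>+ y. ennreal \<bar>u T y - sticky_cdf lam n x T y\<bar> \<partial>lborel) = (\<integral>\<^sup>+ y. (SUP r. ?F r y) \<partial>lborel)"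
    unfolding sup using T by (simp add: U_eq)
  also have "\<dots> = (SUP r. \<integral>\<^sup>+ y. ?F r y \<partial>lborel)"
    by (intro nn_integral_monotone_convergence_SUP inc) measurable
  also have "\<dots> \<le> ennreal (L / (2 * real n) * T)"
    by (intro SUP_least part)
  finally show ?thesis .
qed

end

theorem proposition3p2:
  fixes \<Lambda> lam :: "real \<Rightarrow> real" and L :: real
    and n :: nat and x :: "nat \<Rightarrow> real"
    and u :: "real \<Rightarrow> real \<Rightarrow> real" and t :: real
  assumes "\<And>w. w \<in> {0..1} \<Longrightarrow> (\<Lambda> has_real_derivative lam w) (at w within {0..1})"
    and "continuous_on {0..1} lam"
    and "L-lipschitz_on {0..1} lam"
    and "n \<ge> 1"
    and "mono_on {1..n} x"
    and "entropy_solution \<Lambda> (cdf (empirical_measure n x)) u"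
    and "t \<ge> 0"
  shows "(\<integral>\<^sup>+ y. ennreal \<bar>u t y - sticky_cdf lam n x t y\<bar> \<partial>lborel) \<le> ennreal (t * L / real n)"
proof -
  obtain g g' :: "real \<Rightarrow> real" where g:
    "smooth_line g" "\<And>y. (g has_real_derivative g' y) (at y)" "\<And>y. 0 \<le> g' y"
    "\<And>y. y \<le> 0 \<Longrightarrow> g y = 0" "\<And>y. y \<ge> 1 \<Longrightarrow> g y = 1" "\<And>y. y \<notin> {0<..<1} \<Longrightarrow> g' y = 0"
    "continuous_on UNIV g'"
    by (rule smooth_step_exists) blast
  interpret kruzkov_setting \<Lambda> lam L n x u g g'
    by unfold_locales (use assms g in auto)
  have "L / (2 * real n) * t \<le> t * L / real n"
    using assms(4,7) L_nonneg by (simp add: field_simps)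
  then show ?thesis
    using distance_le[OF assms(7)] by (meson ennreal_leI order_trans)
qed

end
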